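(* Let $\alpha,\beta,\gamma\in\mathbb{R}$ satisfy $\alpha>-\frac12$, $\gamma>-1$ and $\alpha+\beta+\gamma>-\frac32$. Let $\{X_t,\ t\ge 0\}$ be a path-continuous modification of the process $$X_t=\int_0^t s^{\alpha}\int_s^t u^{\beta}(u-s)^{\gamma}\,du\,dW_s,\qquad t\ge 0,$$ where $W$ is a Wiener process. Then, almost surely, $$\limsup_{t\to\infty}\frac{|X_t|}{t^{\alpha+\beta+\gamma+3/2}\,(2\log\log t)^{1/2}}\le \sqrt{\mathsf{E}X_1^2}<\infty$$ and $$\sup_{t\ge 3}\frac{|X_t|}{t^{\alpha+\beta+\gamma+3/2}\,(\log\log t)^{1/2}}<\infty .$$
   Context: $W=\{W_t,\ t\ge0\}$ is a standard Wiener process, and the outer integral defining $X_t$ is the Wiener integral of the deterministic kernel $K(t,s)=s^\alpha\int_s^t u^\beta(u-s)^\gamma\,du$, $0<s<t$ (with $X_0=0$). Under the stated conditions on $\alpha,\beta,\gamma$ the process $X$ is well defined and has a modification with continuous paths on $[0,\infty)$ (known facts). $\mathsf{E}$ denotes expectation. *)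

theory Defs
  imports "HOL-Probability.Probability"
begin

text \<open>The time set is \<open>[0, \<infinity>)\<close>; the values \<open>W t\<close> for \<open>t < 0\<close> are unconstrained and never used.\<close>

locale wiener_process = prob_space M
  for M :: "'a measure" and W :: "real \<Rightarrow> 'a \<Rightarrow> real" +
  assumes random_variable: "0 \<le> t \<Longrightarrow> W t \<in> borel_measurable M"
    and start: "AE \<omega> in M. W 0 \<omega> = 0"
    and indep_increments:
      "\<lbrakk>0 \<le> p 0; \<And>i. i < n \<Longrightarrow> p i < p (Suc i)\<rbrakk> \<Longrightarrow>
        indep_vars (\<lambda>_. borel) (\<lambda>i \<omega>. W (p (Suc i)) \<omega> - W (p i) \<omega>) {..<n}"
    and normal_increments:
      "\<lbrakk>0 \<le> s; s < t\<rbrakk> \<Longrightarrow>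
        distributed M lborel (\<lambda>\<omega>. W t \<omega> - W s \<omega>) (normal_density 0 (sqrt (t - s)))"
    and continuous_paths: "AE \<omega> in M. continuous_on {0..} (\<lambda>t. W t \<omega>)"

definition step_function :: "nat \<Rightarrow> (nat \<Rightarrow> real) \<Rightarrow> (nat \<Rightarrow> real) \<Rightarrow> real \<Rightarrow> real" where
  "step_function n p c s = (\<Sum>i<n. c i * indicator {p i<..p (Suc i)} s)"

definition step_wiener_integral ::
  "(real \<Rightarrow> 'a \<Rightarrow> real) \<Rightarrow> nat \<Rightarrow> (nat \<Rightarrow> real) \<Rightarrow> (nat \<Rightarrow> real) \<Rightarrow> 'a \<Rightarrow> real" where
  "step_wiener_integral W n p c \<omega> = (\<Sum>i<n. c i * (W (p (Suc i)) \<omega> - W (p i) \<omega>))"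

definition partition_in :: "real \<Rightarrow> nat \<Rightarrow> (nat \<Rightarrow> real) \<Rightarrow> bool" where
  "partition_in T n p \<longleftrightarrow> 0 \<le> p 0 \<and> (\<forall>i<n. p i \<le> p (Suc i)) \<and> p n \<le> T"

text \<open>
  The random variable \<open>I\<close> is a version of the Wiener integral of \<open>f\<close> over \<open>[0, T]\<close>: it is the
  limit in \<open>L\<^sup>2(M)\<close> of the integrals of step functions that converge to \<open>f\<close> in \<open>L\<^sup>2([0, T])\<close>.
  By the Wiener isometry this determines \<open>I\<close> up to almost sure equality. The \<open>L\<^sup>2\<close> distances are
  nonnegative integrals, so that convergence to zero forces them to be eventually finite (a Bochner
  integral would be \<open>0\<close> for a non-integrable argument); in particular \<open>f\<close> and \<open>I\<close> are
  square integrable.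
\<close>

definition has_wiener_integral ::
  "'a measure \<Rightarrow> (real \<Rightarrow> 'a \<Rightarrow> real) \<Rightarrow> real \<Rightarrow> (real \<Rightarrow> real) \<Rightarrow> ('a \<Rightarrow> real) \<Rightarrow> bool" where
  "has_wiener_integral M W T f I \<longleftrightarrow>
    set_borel_measurable lborel {0..T} f \<and>
    I \<in> borel_measurable M \<and>
    (\<exists>n p c.
      (\<forall>k. partition_in T (n k) (p k)) \<and>
      (\<lambda>k. \<integral>\<^sup>+ s\<in>{0..T}. ennreal ((f s - step_function (n k) (p k) (c k) s)\<^sup>2) \<partial>lborel)
        \<longlonglongrightarrow> 0 \<and>
      (\<lambda>k. \<integral>\<^sup>+ \<omega>. ennreal ((I \<omega> - step_wiener_integral W (n k) (p k) (c k) \<omega>)\<^sup>2) \<partial>M)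
        \<longlonglongrightarrow> 0)"

text \<open>Only the values for \<open>0 < s < t\<close> matter; \<open>0 powr x = 0\<close> affects null sets only.\<close>

definition volterra_kernel :: "real \<Rightarrow> real \<Rightarrow> real \<Rightarrow> real \<Rightarrow> real \<Rightarrow> real" where
  "volterra_kernel \<alpha> \<beta> \<gamma> t s =
    s powr \<alpha> * (LBINT u:{s..t}. u powr \<beta> * (u - s) powr \<gamma>)"

text \<open>
  The integral process is defined only up to modification, so a path-continuous modification is any
  process whose value at each time is a version of the corresponding Wiener integral and almost all
  of whose paths are continuous (at \<open>t = 0\<close> this gives \<open>X 0 = 0\<close> almost surely).
\<close>

definition continuous_volterra_process ::
  "'a measure \<Rightarrow> (real \<Rightarrow> 'a \<Rightarrow> real) \<Rightarrow> real \<Rightarrow> real \<Rightarrow> real \<Rightarrow> (real \<Rightarrow> 'a \<Rightarrow> real) \<Rightarrow> bool" where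
  "continuous_volterra_process M W \<alpha> \<beta> \<gamma> X \<longleftrightarrow>
    (\<forall>t\<ge>0. has_wiener_integral M W t (volterra_kernel \<alpha> \<beta> \<gamma> t) (X t)) \<and>
    (AE \<omega> in M. continuous_on {0..} (\<lambda>t. X t \<omega>))"

end

theory Submission
  imports Defs
begin

text \<open>
  The Lamperti transform \<open>Y\<^bsub>u\<^esub> = exp (- H u) X\<^bsub>exp u\<^esub>\<close> with \<open>H = \<alpha> + \<beta> + \<gamma> + 3 / 2\<close> turns the claim
  into \<open>limsup \<bar>Y\<^bsub>u\<^esub>\<bar> / sqrt (2 ln u) \<le> sqrt (E X\<^sub>1\<^sup>2)\<close>. By the Wiener isometry and the scaling of the
  kernel, \<open>Y\<^bsub>u\<^esub>\<close> is centred Gaussian with variance \<open>E X\<^sub>1\<^sup>2\<close>, and its increments over a step \<open>h \<le> 1\<close> have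
  variance at most \<open>C h powr (2 d)\<close> for \<open>d = min 1 (\<gamma> + 1)\<close>. Along \<open>u\<^sub>n = n powr a\<close>, with \<open>a < 1\<close> close to \<open>1\<close>,
  the Gaussian tail bound and Borel-Cantelli control \<open>Y\<close> at the grid points. Between grid points the mesh
  is a negative power of \<open>n\<close>, so dyadic chaining and a second application of Borel-Cantelli bound the
  oscillation by a constant, which is negligible against \<open>sqrt (2 ln u)\<close>.
\<close>

section \<open>Gaussian integrals of step functions\<close>

text \<open>Two opposing demands fix the grid exponent. Since
  \<open>ln (n powr a) = a * ln n\<close>, the level \<open>c' * sqrt (2 * ln u)\<close> is exceeded
  at the n-th grid point with probability at most of order \<open>n powr (- (a * c'^2 / w))\<close>,
  where w lies just above the variance, so summability forces \<open>a > w / c'^2\<close>. For a =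
  1, however, the mesh would be constantly 1 and the bound on the probability of a large oscillation
  in one cell would not decay. Any a < 1 gives mesh at most \<open>n powr (a - 1)\<close>, and since
  a Gaussian tail beats every power, that probability is bounded by an arbitrarily high power of the
  mesh. Only an upper bound is at stake, so tail estimates for single values and single increments
  of Y suffice, and Gaussianity enters solely as a tail bound, which passes from step integrals to
  their limits in mean square. The parameter conditions act at separate places: \<gamma> > -1 gives
  the increment exponent d > 0, \<alpha> > -1/2 makes \<open>s powr (2 * \<alpha>)\<close>
  integrable at 0, and the condition on the sum says H > 0, which keeps the normalising factor
  \<open>exp (- H * h)\<close> in (0, 1].\<close>

lemma nn_integral_square_le:
  fixes f g :: "'a \<Rightarrow> real"
  assumes [measurable]: "f \<in> borel_measurable M" "g \<in> borel_measurable M" and "0 < e"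
  shows "(\<integral>\<^sup>+ x. ennreal ((f x)\<^sup>2) \<partial>M) \<le>
    ennreal (1 + e) * (\<integral>\<^sup>+ x. ennreal ((g x)\<^sup>2) \<partial>M) +
    ennreal (1 + 1 / e) * (\<integral>\<^sup>+ x. ennreal ((f x - g x)\<^sup>2) \<partial>M)"
proof -
  have "(f x)\<^sup>2 \<le> (1 + e) * (g x)\<^sup>2 + (1 + 1 / e) * (f x - g x)\<^sup>2" for x
  proof -
    \<comment> \<open>Young's inequality with weight \<open>e\<close>: the defect is a perfect
      square. Keeping \<open>1 + e\<close> instead of a fixed factor lets \<open>e\<close> tend to 0
      later, so that limits retain the exact norm.\<close>
    have "(1 + e) * (g x)\<^sup>2 + (1 + 1 / e) * (f x - g x)\<^sup>2 - (f x)\<^sup>2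
        = (e * g x - (f x - g x))\<^sup>2 / e"
      using \<open>0 < e\<close> by (simp add: field_simps power2_eq_square)
    moreover have "\<dots> \<ge> 0" using \<open>0 < e\<close> by simp
    ultimately show ?thesis by linarith
  qed
  then have "(\<integral>\<^sup>+ x. ennreal ((f x)\<^sup>2) \<partial>M) \<le>
      (\<integral>\<^sup>+ x. ennreal (1 + e) * ennreal ((g x)\<^sup>2) + ennreal (1 + 1 / e) * ennreal ((f x - g x)\<^sup>2) \<partial>M)"
    using \<open>0 < e\<close>
    by (intro nn_integral_mono) (simp add: ennreal_mult[symmetric] ennreal_plus[symmetric] del: ennreal_plus)
  also have "\<dots> = ennreal (1 + e) * (\<integral>\<^sup>+ x. ennreal ((g x)\<^sup>2) \<partial>M) +
      ennreal (1 + 1 / e) * (\<integral>\<^sup>+ x. ennreal ((f x - g x)\<^sup>2) \<partial>M)"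
    by (simp add: nn_integral_add nn_integral_cmult)
  finally show ?thesis .
qed

section \<open>Moments and tails of centred normal variables\<close>

context prob_space
begin

lemma normal_exp_moment:
  assumes "0 < \<sigma>" and D: "distributed M lborel Z (normal_density 0 \<sigma>)"
  shows "(\<integral>\<^sup>+ \<omega>. ennreal (exp (l * Z \<omega>)) \<partial>M) = ennreal (exp (l\<^sup>2 * \<sigma>\<^sup>2 / 2))"
proof -
  \<comment> \<open>Completing the square: exponential tilting by \<open>l\<close> shifts the mean
    of the density to \<open>l * \<sigma>^2\<close> and leaves the moment as a constant
    factor.\<close>
  have eq: "normal_density 0 \<sigma> x * exp (l * x) = exp (l\<^sup>2 * \<sigma>\<^sup>2 / 2) * normal_density (l * \<sigma>\<^sup>2) \<sigma> x" for x
  proof -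
    have "- (x - 0)\<^sup>2 / (2 * \<sigma>\<^sup>2) + l * x = l\<^sup>2 * \<sigma>\<^sup>2 / 2 + - (x - l * \<sigma>\<^sup>2)\<^sup>2 / (2 * \<sigma>\<^sup>2)"
      using assms(1) by (simp add: field_simps power2_eq_square)
    then show ?thesis
      unfolding normal_density_def by (simp add: exp_add[symmetric] del: diff_zero)
  qed
  have "(\<integral>\<^sup>+ \<omega>. ennreal (exp (l * Z \<omega>)) \<partial>M) =
      (\<integral>\<^sup>+ x. ennreal (normal_density 0 \<sigma> x) * ennreal (exp (l * x)) \<partial>lborel)"
    by (rule distributed_nn_integral[OF D, symmetric]) measurable
  also have "\<dots> = (\<integral>\<^sup>+ x. ennreal (exp (l\<^sup>2 * \<sigma>\<^sup>2 / 2)) * ennreal (normal_density (l * \<sigma>\<^sup>2) \<sigma> x) \<partial>lborel)"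
    by (simp add: ennreal_mult[symmetric] eq)
  also have "\<dots> = ennreal (exp (l\<^sup>2 * \<sigma>\<^sup>2 / 2)) * (\<integral>\<^sup>+ x. ennreal (normal_density (l * \<sigma>\<^sup>2) \<sigma> x) \<partial>lborel)"
    by (rule nn_integral_cmult) measurable
  also have "(\<integral>\<^sup>+ x. ennreal (normal_density (l * \<sigma>\<^sup>2) \<sigma> x) \<partial>lborel) = 1"
    using assms(1) by (subst nn_integral_eq_integral) (auto intro!: integrable_normal_density)
  finally show ?thesis by simp
qed

lemma normal_second_moment:
  assumes "0 < \<sigma>" and D: "distributed M lborel Z (normal_density 0 \<sigma>)"
  shows "(\<integral>\<^sup>+ \<omega>. ennreal ((Z \<omega>)\<^sup>2) \<partial>M) = ennreal (\<sigma>\<^sup>2)"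
proof -
  have "(\<integral>\<^sup>+ \<omega>. ennreal ((Z \<omega>)\<^sup>2) \<partial>M) =
      (\<integral>\<^sup>+ x. ennreal (normal_density 0 \<sigma> x) * ennreal (x\<^sup>2) \<partial>lborel)"
    by (rule distributed_nn_integral[OF D, symmetric]) measurable
  also have "\<dots> = (\<integral>\<^sup>+ x. ennreal (normal_density 0 \<sigma> x * x\<^sup>2) \<partial>lborel)"
    by (simp add: ennreal_mult[symmetric])
  also have "\<dots> = ennreal (\<sigma>\<^sup>2)"
  proof -
    have "has_bochner_integral lborel (\<lambda>x. normal_density 0 \<sigma> x * x\<^sup>2) (\<sigma>\<^sup>2)"
      using normal_moment_even[OF assms(1), of 0 1] by simp
    then show ?thesis
      by (subst nn_integral_eq_integral)
        (auto simp: has_bochner_integral_iff)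
  qed
  finally show ?thesis .
qed

text \<open>Chernoff's bound for each of the two signs, whence the factor 2. That factor also makes
  the claim trivial at \<open>y = 0\<close>, where the Chernoff parameter would fail to be
  positive.\<close>

lemma normal_tail:
  assumes "0 < \<sigma>" and D: "distributed M lborel Z (normal_density 0 \<sigma>)" and "0 \<le> y"
  shows "prob {\<omega> \<in> space M. y \<le> \<bar>Z \<omega>\<bar>} \<le> 2 * exp (- y\<^sup>2 / (2 * \<sigma>\<^sup>2))"
proof (cases "y = 0")
  case True
  then show ?thesis by (auto intro: order_trans[OF prob_le_1])
next
  case False
  with \<open>0 \<le> y\<close> have y: "0 < y" by simp
  have [measurable]: "Z \<in> borel_measurable M"
    using distributed_measurable[OF D] by simp
  have one: "prob {\<omega> \<in> space M. y \<le> s * Z \<omega>} \<le> exp (- y\<^sup>2 / (2 * \<sigma>\<^sup>2))" if s: "s * s = 1" for s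
  proof -
    \<comment> \<open>This value minimises the exponent
      \<open>- l * y + l^2 * \<sigma>^2 / 2\<close>.\<close>
    define l where "l = y / \<sigma>\<^sup>2"
    have l: "0 < l" using y assms(1) by (simp add: l_def)
    have "emeasure M {\<omega> \<in> space M. s * Z \<omega> \<ge> y} \<le>
        ennreal (exp (- l * y)) * (\<integral>\<^sup>+ \<omega>. ennreal (exp (l * (s * Z \<omega>))) * indicator (space M) \<omega> \<partial>M)"
      by (rule Chernoff_ineq_nn_integral_ge[OF l]) auto
    also have "(\<integral>\<^sup>+ \<omega>. ennreal (exp (l * (s * Z \<omega>))) * indicator (space M) \<omega> \<partial>M)
        = (\<integral>\<^sup>+ \<omega>. ennreal (exp ((l * s) * Z \<omega>)) \<partial>M)"
      by (intro nn_integral_cong) (simp add: mult.assoc)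
    also have "\<dots> = ennreal (exp ((l * s)\<^sup>2 * \<sigma>\<^sup>2 / 2))"
      by (rule normal_exp_moment[OF assms(1) D])
    also have "(l * s)\<^sup>2 = l\<^sup>2" using s by (simp add: power2_eq_square algebra_simps)
    also have "ennreal (exp (- l * y)) * ennreal (exp (l\<^sup>2 * \<sigma>\<^sup>2 / 2)) = ennreal (exp (- y\<^sup>2 / (2 * \<sigma>\<^sup>2)))"
    proof -
      have "- l * y + l\<^sup>2 * \<sigma>\<^sup>2 / 2 = - y\<^sup>2 / (2 * \<sigma>\<^sup>2)"
        using assms(1) by (simp add: l_def field_simps power2_eq_square)
      then show ?thesis by (simp add: ennreal_mult[symmetric] exp_add[symmetric])
    qed
    finally show ?thesis by (simp add: emeasure_eq_measure)
  qed
  have "prob {\<omega> \<in> space M. y \<le> \<bar>Z \<omega>\<bar>}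
      \<le> prob ({\<omega> \<in> space M. y \<le> 1 * Z \<omega>} \<union> {\<omega> \<in> space M. y \<le> (-1) * Z \<omega>})"
    by (rule finite_measure_mono) auto
  also have "\<dots> \<le> prob {\<omega> \<in> space M. y \<le> 1 * Z \<omega>} + prob {\<omega> \<in> space M. y \<le> (-1) * Z \<omega>}"
    by (rule measure_Un_le) auto
  also have "\<dots> \<le> 2 * exp (- y\<^sup>2 / (2 * \<sigma>\<^sup>2))"
    using one[of 1] one[of "-1"] by simp
  finally show ?thesis .
qed

end

text \<open>Every coarse partition point is a point of the fine grid, so each coarse increment
  telescopes into fine ones. Coarse intervals are open on the left and closed on the right, so a
  fine cell lies in one exactly when its right end point does; hence the new coefficient is the step
  function evaluated at \<open>p (Suc j)\<close>. The integrator \<open>g\<close> is arbitrary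
  because the identity is pathwise, which allows it to be reused for the step functions
  themselves.\<close>

lemma step_wiener_integral_refine:
  assumes p: "strict_mono_on {..N} p" and q: "\<And>i. i < n \<Longrightarrow> q i \<le> q (Suc i)"
    and q_p: "\<And>i. i \<le> n \<Longrightarrow> q i \<in> p ` {..N}"
  shows "step_wiener_integral g n q c \<omega> =
    step_wiener_integral g N p (\<lambda>j. step_function n q c (p (Suc j))) \<omega>"
proof -
  have less: "p i < p j \<longleftrightarrow> i < j" if "i \<le> N" "j \<le> N" for i j
    using p that by (metis strict_mono_on_less atMost_iff)
  have one: "(\<Sum>j<N. indicator {a<..b} (p (Suc j)) * (g (p (Suc j)) \<omega> - g (p j) \<omega>)) = g b \<omega> - g a \<omega>"
    if a: "a \<in> p ` {..N}" and b: "b \<in> p ` {..N}" and ab: "a \<le> b" for a b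
  proof -
    obtain i k where ik: "a = p i" "i \<le> N" "b = p k" "k \<le> N" using a b by auto
    have "i \<le> k" using ab ik less[of k i] by (meson not_less)
    have "(\<Sum>j<N. indicator {a<..b} (p (Suc j)) * (g (p (Suc j)) \<omega> - g (p j) \<omega>))
        = (\<Sum>j<N. if j \<in> {i..<k} then g (p (Suc j)) \<omega> - g (p j) \<omega> else 0)"
    proof (rule sum.cong)
      fix j assume j: "j \<in> {..<N}"
      have "p (Suc j) \<in> {a<..b} \<longleftrightarrow> j \<in> {i..<k}"
        using less[of i "Suc j"] less[of k "Suc j"] ik j by (auto simp: not_less[symmetric])
      then show "indicator {a<..b} (p (Suc j)) * (g (p (Suc j)) \<omega> - g (p j) \<omega>)
          = (if j \<in> {i..<k} then g (p (Suc j)) \<omega> - g (p j) \<omega> else 0)"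
        by (simp add: indicator_def)
    qed simp
    also have "\<dots> = (\<Sum>j\<in>{..<N} \<inter> {i..<k}. g (p (Suc j)) \<omega> - g (p j) \<omega>)"
      by (simp add: sum.inter_restrict)
    also have "{..<N} \<inter> {i..<k} = {i..<k}" using ik by auto
    also have "(\<Sum>j\<in>{i..<k}. g (p (Suc j)) \<omega> - g (p j) \<omega>) = g (p k) \<omega> - g (p i) \<omega>"
      by (rule sum_Suc_diff'[OF \<open>i \<le> k\<close>])
    finally show ?thesis using ik by simp
  qed
  have "step_wiener_integral g N p (\<lambda>j. step_function n q c (p (Suc j))) \<omega>
      = (\<Sum>j<N. \<Sum>i<n. c i * (indicator {q i<..q (Suc i)} (p (Suc j)) * (g (p (Suc j)) \<omega> - g (p j) \<omega>)))"
    unfolding step_wiener_integral_def step_function_def sum_distrib_right mult.assoc ..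
  also have "\<dots> = (\<Sum>i<n. c i * (\<Sum>j<N. indicator {q i<..q (Suc i)} (p (Suc j)) * (g (p (Suc j)) \<omega> - g (p j) \<omega>)))"
    by (subst sum.swap) (simp only: sum_distrib_left)
  also have "\<dots> = (\<Sum>i<n. c i * (g (q (Suc i)) \<omega> - g (q i) \<omega>))"
    by (intro sum.cong refl arg_cong2[where f="(*)"] one q_p q) auto
  finally show ?thesis by (simp add: step_wiener_integral_def)
qed

text \<open>The indicator of a half-open interval is an increment of
  \<open>t \<mapsto> indicator {s..} t\<close>. With this integrator, where \<open>s\<close> takes
  the place of the sample point, refinement of step functions becomes a case of refinement of step
  integrals.\<close>

lemma step_function_eq_step_wiener_integral:
  assumes "\<And>i. i < n \<Longrightarrow> q i \<le> q (Suc i)"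
  shows "step_function n q c s = step_wiener_integral (\<lambda>t s. indicator {s..} t) n q c s"
  unfolding step_function_def step_wiener_integral_def
proof (intro sum.cong refl arg_cong2[where f="(*)"])
  fix i assume "i \<in> {..<n}"
  then have "q i \<le> q (Suc i)" using assms by simp
  then show "indicator {q i<..q (Suc i)} s = (indicator {s..} (q (Suc i)) - indicator {s..} (q i) :: real)"
    by (auto simp: indicator_def)
qed

lemma step_function_refine:
  assumes p: "strict_mono_on {..N} p" and q: "\<And>i. i < n \<Longrightarrow> q i \<le> q (Suc i)"
    and q_p: "\<And>i. i \<le> n \<Longrightarrow> q i \<in> p ` {..N}"
  shows "step_function n q c s = step_function N p (\<lambda>j. step_function n q c (p (Suc j))) s"
proof -
  have p': "p i \<le> p (Suc i)" if "i < N" for i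
    using p that by (auto simp: strict_mono_on_def less_imp_le)
  have "step_function n q c s = step_wiener_integral (\<lambda>t s. indicator {s..} t) n q c s"
    by (rule step_function_eq_step_wiener_integral) (rule q)
  also have "\<dots> = step_wiener_integral (\<lambda>t s. indicator {s..} t) N p
      (\<lambda>j. step_function n q c (p (Suc j))) s"
    by (rule step_wiener_integral_refine) (use p q q_p in auto)
  also have "\<dots> = step_function N p (\<lambda>j. step_function n q c (p (Suc j))) s"
    by (rule step_function_eq_step_wiener_integral[symmetric]) (rule p')
  finally show ?thesis .
qed

text \<open>Strict grids remove empty cells: the Wiener increments are specified only over intervals
  of positive length, while the partitions in the definition of the integral may repeat
  points.\<close>

lemma finite_set_grid:
  fixes A :: "real set"
  assumes "finite A" "A \<noteq> {}"
  obtains N p where "strict_mono_on {..N::nat} p" "p ` {..N} = A"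
proof -
  define xs where "xs = sorted_list_of_set A"
  have xs: "set xs = A" "sorted_wrt (<) xs" "length xs = card A"
    using assms by (auto simp: xs_def)
  have "card A > 0" using assms by (simp add: card_gt_0_iff)
  then have len: "{..card A - 1} = {..<length xs}" using xs by auto
  have "strict_mono_on {..card A - 1} ((!) xs)"
    unfolding len strict_mono_on_def using sorted_wrt_nth_less[OF xs(2)] by auto
  moreover have "(!) xs ` {..card A - 1} = A"
    unfolding len using xs by (auto simp: set_conv_nth)
  ultimately show ?thesis by (rule that)
qed

lemma step_function_measurable [measurable]: "step_function n p c \<in> borel_measurable borel"
  unfolding step_function_def by measurable

text \<open>On a strict grid the half-open cells are disjoint, so at most one summand is nonzero at
  each point and the square produces no cross terms.\<close>

lemma nn_integral_step_function_square:
  assumes p: "strict_mono_on {..N} p"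
  shows "(\<integral>\<^sup>+ s. ennreal ((step_function N p c s)\<^sup>2) \<partial>lborel) =
    ennreal (\<Sum>i<N. (c i)\<^sup>2 * (p (Suc i) - p i))"
proof -
  have less: "p i < p j" if "i < j" "j \<le> N" for i j
    using p that by (auto simp: strict_mono_on_def)
  have mono: "p i \<le> p j" if "i \<le> j" "j \<le> N" for i j
    using less[of i j] that by (auto simp: order_le_less)
  have sq: "(step_function N p c s)\<^sup>2 = (\<Sum>i<N. (c i)\<^sup>2 * indicator {p i<..p (Suc i)} s)" for s
  proof (cases "\<exists>i<N. s \<in> {p i<..p (Suc i)}")
    case True
    then obtain i where i: "i < N" "s \<in> {p i<..p (Suc i)}" by auto
    have other: "s \<notin> {p j<..p (Suc j)}" if "j < N" "j \<noteq> i" for j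
    proof (cases "j < i")
      case True
      then show ?thesis using mono[of "Suc j" i] i by auto
    next
      case False
      then show ?thesis using mono[of "Suc i" j] i that by auto
    qed
    have "step_function N p c s = (\<Sum>j\<in>{i}. c j * indicator {p j<..p (Suc j)} s)"
      unfolding step_function_def using i other by (intro sum.mono_neutral_right) auto
    moreover have "(\<Sum>j<N. (c j)\<^sup>2 * indicator {p j<..p (Suc j)} s)
        = (\<Sum>j\<in>{i}. (c j)\<^sup>2 * indicator {p j<..p (Suc j)} s)"
      using i other by (intro sum.mono_neutral_right) auto
    ultimately show ?thesis using i(2) by (simp only: sum.insert finite.emptyI sum.empty empty_iff
          not_False_eq_True indicator_simps mult_1_right add_0_right)
  next
    case False
    then have "indicator {p i<..p (Suc i)} s = (0::real)" if "i < N" for i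
      using that by (auto simp: indicator_def)
    then show ?thesis by (simp add: step_function_def)
  qed
  have "(\<integral>\<^sup>+ s. ennreal ((step_function N p c s)\<^sup>2) \<partial>lborel)
      = (\<integral>\<^sup>+ s. (\<Sum>i<N. ennreal ((c i)\<^sup>2) * indicator {p i<..p (Suc i)} s) \<partial>lborel)"
  proof (rule nn_integral_cong)
    fix s
    have "ennreal ((step_function N p c s)\<^sup>2) = (\<Sum>i<N. ennreal ((c i)\<^sup>2 * indicator {p i<..p (Suc i)} s))"
      unfolding sq by (rule sum_ennreal[symmetric]) simp
    also have "\<dots> = (\<Sum>i<N. ennreal ((c i)\<^sup>2) * indicator {p i<..p (Suc i)} s)"
      by (intro sum.cong refl) (simp add: indicator_def)
    finally show "ennreal ((step_function N p c s)\<^sup>2)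
        = (\<Sum>i<N. ennreal ((c i)\<^sup>2) * indicator {p i<..p (Suc i)} s)" .
  qed
  also have "\<dots> = (\<Sum>i<N. \<integral>\<^sup>+ s. ennreal ((c i)\<^sup>2) * indicator {p i<..p (Suc i)} s \<partial>lborel)"
    by (rule nn_integral_sum) measurable
  also have "\<dots> = (\<Sum>i<N. ennreal ((c i)\<^sup>2 * (p (Suc i) - p i)))"
  proof (rule sum.cong[OF refl])
    fix i assume "i \<in> {..<N}"
    then have "p i \<le> p (Suc i)" using mono by simp
    then show "(\<integral>\<^sup>+ s. ennreal ((c i)\<^sup>2) * indicator {p i<..p (Suc i)} s \<partial>lborel)
        = ennreal ((c i)\<^sup>2 * (p (Suc i) - p i))"
      by (simp add: nn_integral_cmult_indicator ennreal_mult)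
  qed
  also have "\<dots> = ennreal (\<Sum>i<N. (c i)\<^sup>2 * (p (Suc i) - p i))"
    by (rule sum_ennreal) (simp add: mono)
  finally show ?thesis .
qed

section \<open>Step integrals as centred Gaussian variables\<close>

context wiener_process
begin

lemma step_wiener_integral_measurable:
  assumes "\<And>i. i \<le> n \<Longrightarrow> 0 \<le> p i"
  shows "step_wiener_integral W n p c \<in> borel_measurable M"
proof -
  have [measurable]: "W (p i) \<in> borel_measurable M" if "i \<le> n" for i
    using assms that random_variable by auto
  show ?thesis unfolding step_wiener_integral_def
    by (intro borel_measurable_sum borel_measurable_times borel_measurable_const borel_measurable_diff)
       auto
qed

text \<open>Variances of independent normal increments add. The case \<open>v = 0\<close> stands
  apart because a constant variable has no Lebesgue density.\<close>

lemma step_wiener_integral_normal: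
  fixes c p :: "nat \<Rightarrow> real"
  assumes p: "strict_mono_on {..N} p" and p0: "0 \<le> p 0"
  defines "v \<equiv> \<Sum>i<N. (c i)\<^sup>2 * (p (Suc i) - p i)"
  shows "v = 0 \<and> step_wiener_integral W N p c = (\<lambda>_. 0) \<or>
    v > 0 \<and> distributed M lborel (step_wiener_integral W N p c) (normal_density 0 (sqrt v))"
proof -
  have less: "p i < p j" if "i < j" "j \<le> N" for i j
    using p that by (auto simp: strict_mono_on_def)
  have nonneg: "0 \<le> p i" if "i \<le> N" for i
    using less[of 0 i] p0 that by (cases i) auto
  \<comment> \<open>Cells with coefficient 0 are discarded: their summands are degenerate, whereas
    the theorem on sums of independent normal variables requires positive standard
    deviations.\<close>
  define I where "I = {i\<in>{..<N}. c i \<noteq> 0}"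
  have S: "step_wiener_integral W N p c = (\<lambda>\<omega>. \<Sum>i\<in>I. c i * (W (p (Suc i)) \<omega> - W (p i) \<omega>))"
    unfolding step_wiener_integral_def I_def by (intro ext sum.mono_neutral_right) auto
  have v: "v = (\<Sum>i\<in>I. (c i)\<^sup>2 * (p (Suc i) - p i))"
    unfolding v_def I_def by (intro sum.mono_neutral_right) auto
  show ?thesis
  proof (cases "I = {}")
    case True
    then show ?thesis using S v by simp
  next
    case False
    have pos: "0 < (c i)\<^sup>2 * (p (Suc i) - p i)" if "i \<in> I" for i
      using that less[of i "Suc i"] by (auto simp: I_def)
    have "v > 0" unfolding v using False pos by (intro sum_pos) (auto simp: I_def)
    have ind: "indep_vars (\<lambda>_. borel) (\<lambda>i \<omega>. c i * (W (p (Suc i)) \<omega> - W (p i) \<omega>)) I"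
    proof (rule indep_vars_compose2[where Y="\<lambda>i x. c i * x" and M'="\<lambda>_. borel"])
      have "indep_vars (\<lambda>_. borel) (\<lambda>i \<omega>. W (p (Suc i)) \<omega> - W (p i) \<omega>) {..<N}"
        by (rule indep_increments) (auto simp: p0 less)
      then show "indep_vars (\<lambda>_. borel) (\<lambda>i \<omega>. W (p (Suc i)) \<omega> - W (p i) \<omega>) I"
        by (rule indep_vars_subset) (auto simp: I_def)
    qed auto
    have "distributed M lborel (\<lambda>\<omega>. \<Sum>i\<in>I. c i * (W (p (Suc i)) \<omega> - W (p i) \<omega>))
        (normal_density (\<Sum>i\<in>I. 0) (sqrt (\<Sum>i\<in>I. (\<bar>c i\<bar> * sqrt (p (Suc i) - p i))\<^sup>2)))"
    proof (rule sum_indep_normal[OF _ False ind])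
      fix i assume i: "i \<in> I"
      then have lt: "p i < p (Suc i)" using less by (auto simp: I_def)
      then show "0 < \<bar>c i\<bar> * sqrt (p (Suc i) - p i)" using i by (auto simp: I_def)
      have "distributed M lborel (\<lambda>\<omega>. 0 + c i * (W (p (Suc i)) \<omega> - W (p i) \<omega>))
          (normal_density (0 + c i * 0) (\<bar>c i\<bar> * sqrt (p (Suc i) - p i)))"
        using lt i nonneg[of i]
        by (intro normal_density_affine normal_increments) (auto simp: I_def)
      then show "distributed M lborel (\<lambda>\<omega>. c i * (W (p (Suc i)) \<omega> - W (p i) \<omega>))
          (normal_density 0 (\<bar>c i\<bar> * sqrt (p (Suc i) - p i)))" by simp
    qed (auto simp: I_def)
    moreover have "(\<Sum>i\<in>I. (\<bar>c i\<bar> * sqrt (p (Suc i) - p i))\<^sup>2) = v"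
      unfolding v using less by (intro sum.cong refl) (auto simp: power_mult_distrib I_def less_imp_le)
    ultimately show ?thesis using \<open>v > 0\<close> S by simp
  qed
qed

lemma step_wiener_integral_isometry:
  assumes "strict_mono_on {..N} p" and "0 \<le> p 0"
  shows "(\<integral>\<^sup>+ \<omega>. ennreal ((step_wiener_integral W N p c \<omega>)\<^sup>2) \<partial>M) =
    (\<integral>\<^sup>+ s. ennreal ((step_function N p c s)\<^sup>2) \<partial>lborel)"
proof -
  define v where "v = (\<Sum>i<N. (c i)\<^sup>2 * (p (Suc i) - p i))"
  from step_wiener_integral_normal[OF assms, of c, folded v_def]
  consider "v = 0" "step_wiener_integral W N p c = (\<lambda>_. 0)"
    | "v > 0" "distributed M lborel (step_wiener_integral W N p c) (normal_density 0 (sqrt v))" by auto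
  then have "(\<integral>\<^sup>+ \<omega>. ennreal ((step_wiener_integral W N p c \<omega>)\<^sup>2) \<partial>M) = ennreal v"
  proof cases
    case 2
    then show ?thesis using normal_second_moment[of "sqrt v"] by simp
  qed simp
  then show ?thesis
    by (simp add: nn_integral_step_function_square[OF assms(1)] v_def)
qed

text \<open>An upper bound \<open>w\<close> replaces the variance itself, so that one estimate
  serves a whole approximating sequence with varying variances, including degenerate
  members.\<close>

lemma step_wiener_integral_tail:
  assumes "strict_mono_on {..N} p" and "0 \<le> p 0" and "0 \<le> y" and "0 < w"
    and le: "(\<integral>\<^sup>+ s. ennreal ((step_function N p c s)\<^sup>2) \<partial>lborel) \<le> ennreal w"
  shows "prob {\<omega> \<in> space M. y \<le> \<bar>step_wiener_integral W N p c \<omega>\<bar>} \<le> 2 * exp (- y\<^sup>2 / (2 * w))"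
proof -
  define v where "v = (\<Sum>i<N. (c i)\<^sup>2 * (p (Suc i) - p i))"
  from step_wiener_integral_normal[OF assms(1,2), of c, folded v_def]
  consider "step_wiener_integral W N p c = (\<lambda>_. 0)"
    | "v > 0" "distributed M lborel (step_wiener_integral W N p c) (normal_density 0 (sqrt v))" by auto
  then show ?thesis
  proof cases
    case 1
    then show ?thesis
    proof (cases "y = 0")
      case True
      then show ?thesis by (auto intro: order_trans[OF prob_le_1])
    next
      case False
      with \<open>0 \<le> y\<close> show ?thesis by (simp add: 1)
    qed
  next
    case 2
    have "v \<le> w"
      using le \<open>0 < w\<close> nn_integral_step_function_square[OF assms(1), of c] by (simp add: v_def[symmetric])
    have "prob {\<omega> \<in> space M. y \<le> \<bar>step_wiener_integral W N p c \<omega>\<bar>} \<le> 2 * exp (- y\<^sup>2 / (2 * (sqrt v)\<^sup>2))"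
      using 2 assms(3) by (intro normal_tail) auto
    also have "\<dots> \<le> 2 * exp (- y\<^sup>2 / (2 * w))"
      using \<open>v \<le> w\<close> \<open>0 < v\<close> by (simp add: divide_left_mono)
    finally show ?thesis .
  qed
qed

end

section \<open>Limits of step integrals\<close>

text \<open>Young's inequality is applied once on each side of the equality for the approximants.
  Letting \<open>k\<close> tend to infinity leaves a factor \<open>(1 + e)^2\<close>, and then
  \<open>e\<close> tends to 0. The two directions of the isometry are two instances with the roles
  of the spaces exchanged.\<close>

lemma nn_integral_square_limit_le:
  fixes f :: "'a \<Rightarrow> real" and g :: "'b \<Rightarrow> real"
  assumes [measurable]: "f \<in> borel_measurable M" "\<And>k. f' k \<in> borel_measurable M"
    "g \<in> borel_measurable N" "\<And>k. g' k \<in> borel_measurable N"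
    and f: "(\<lambda>k. \<integral>\<^sup>+ x. ennreal ((f x - f' k x)\<^sup>2) \<partial>M) \<longlonglongrightarrow> 0"
    and g: "(\<lambda>k. \<integral>\<^sup>+ x. ennreal ((g x - g' k x)\<^sup>2) \<partial>N) \<longlonglongrightarrow> 0"
    and eq: "\<And>k. (\<integral>\<^sup>+ x. ennreal ((f' k x)\<^sup>2) \<partial>M) = (\<integral>\<^sup>+ x. ennreal ((g' k x)\<^sup>2) \<partial>N)"
  shows "(\<integral>\<^sup>+ x. ennreal ((f x)\<^sup>2) \<partial>M) \<le> (\<integral>\<^sup>+ x. ennreal ((g x)\<^sup>2) \<partial>N)"
proof -
  let ?F = "\<integral>\<^sup>+ x. ennreal ((f x)\<^sup>2) \<partial>M" and ?G = "\<integral>\<^sup>+ x. ennreal ((g x)\<^sup>2) \<partial>N"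
  have bound: "?F \<le> ennreal (1 + e) * (ennreal (1 + e) * ?G)" if e: "0 < e" for e :: real
  proof (rule LIMSEQ_le_const)
    define d where "d k = (\<integral>\<^sup>+ x. ennreal ((f x - f' k x)\<^sup>2) \<partial>M)" for k
    define d' where "d' k = (\<integral>\<^sup>+ x. ennreal ((g x - g' k x)\<^sup>2) \<partial>N)" for k
    have "(\<lambda>k. ennreal (1 + e) * (ennreal (1 + e) * ?G + ennreal (1 + 1 / e) * d' k) + ennreal (1 + 1 / e) * d k)
        \<longlonglongrightarrow> ennreal (1 + e) * (ennreal (1 + e) * ?G + ennreal (1 + 1 / e) * 0) + ennreal (1 + 1 / e) * 0"
      using f g unfolding d_def d'_def
      by (intro tendsto_add tendsto_const ennreal_tendsto_cmult) auto
    then show "(\<lambda>k. ennreal (1 + e) * (ennreal (1 + e) * ?G + ennreal (1 + 1 / e) * d' k) + ennreal (1 + 1 / e) * d k)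
        \<longlonglongrightarrow> ennreal (1 + e) * (ennreal (1 + e) * ?G)" by simp
    have "?F \<le> ennreal (1 + e) * (ennreal (1 + e) * ?G + ennreal (1 + 1 / e) * d' k) + ennreal (1 + 1 / e) * d k" for k
    proof -
      have "?F \<le> ennreal (1 + e) * (\<integral>\<^sup>+ x. ennreal ((f' k x)\<^sup>2) \<partial>M) + ennreal (1 + 1 / e) * d k"
        unfolding d_def using e by (intro nn_integral_square_le) auto
      moreover have "(\<integral>\<^sup>+ x. ennreal ((g' k x)\<^sup>2) \<partial>N) \<le> ennreal (1 + e) * ?G + ennreal (1 + 1 / e) * d' k"
        unfolding d'_def power2_commute[of "g _"] using e by (intro nn_integral_square_le) auto
      ultimately show ?thesis unfolding eq
        by (meson add_right_mono mult_left_mono order_trans zero_le)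
    qed
    then show "\<exists>K. \<forall>k\<ge>K. ?F \<le> ennreal (1 + e) * (ennreal (1 + e) * ?G + ennreal (1 + 1 / e) * d' k) + ennreal (1 + 1 / e) * d k"
      by blast
  qed
  show ?thesis
  proof (cases "?G")
    case (real r)
    have "?F \<le> ennreal ((1 + e) * ((1 + e) * r))" if "0 < e" for e
      using bound[OF that] real that by (simp add: ennreal_mult)
    then have "eventually (\<lambda>e. ?F \<le> ennreal ((1 + e) * ((1 + e) * r))) (at_right 0)"
      by (auto simp: eventually_at_right_less eventually_at_filter)
    moreover have "((\<lambda>e. ennreal ((1 + e) * ((1 + e) * r))) \<longlongrightarrow> ennreal ((1 + 0) * ((1 + 0) * r))) (at_right 0)"
      by (intro tendsto_ennrealI tendsto_intros)
    ultimately have "?F \<le> ennreal ((1 + 0) * ((1 + 0) * r))"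
      by (intro tendsto_lowerbound[where F="at_right (0::real)"]) auto
    then show ?thesis using real by simp
  qed auto
qed

text \<open>The union of the two sets of partition points is a common refinement, on which
  coefficients add cell by cell. With \<open>b = 0\<close> the same lemma turns a partition with
  repeated points into a strict grid.\<close>

lemma step_combination_grid:
  assumes "0 \<le> q 0" "\<And>i. i < n \<Longrightarrow> q i \<le> q (Suc i)"
    and "0 \<le> r 0" "\<And>i. i < m \<Longrightarrow> r i \<le> r (Suc i)"
  shows "\<exists>N p c. strict_mono_on {..N} p \<and> 0 \<le> p 0 \<and>
    step_function N p c = (\<lambda>s. a * step_function n q d s + b * step_function m r e s) \<and>
    step_wiener_integral W N p c = (\<lambda>\<omega>. a * step_wiener_integral W n q d \<omega> + b * step_wiener_integral W m r e \<omega>)"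
proof -
  have pos: "0 \<le> q i" if "i \<le> n" for i
    using that
  proof (induction i)
    case (Suc i)
    then show ?case using assms(2)[of i] by simp
  qed (use assms in auto)
  have pos': "0 \<le> r i" if "i \<le> m" for i
    using that
  proof (induction i)
    case (Suc i)
    then show ?case using assms(4)[of i] by simp
  qed (use assms in auto)
  obtain N p where p: "strict_mono_on {..N::nat} p" "p ` {..N} = q ` {..n} \<union> r ` {..m}"
    by (rule finite_set_grid[of "q ` {..n} \<union> r ` {..m}"]) auto
  have "p 0 \<in> p ` {..N}" by blast
  then have "0 \<le> p 0" unfolding p(2) using pos pos' by auto
  define c where "c = (\<lambda>j. a * step_function n q d (p (Suc j)) + b * step_function m r e (p (Suc j)))"
  have "step_function N p c = (\<lambda>s. a * step_function n q d s + b * step_function m r e s)"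
  proof
    fix s
    have "step_function N p c s = a * step_function N p (\<lambda>j. step_function n q d (p (Suc j))) s
        + b * step_function N p (\<lambda>j. step_function m r e (p (Suc j))) s"
      by (simp add: step_function_def[of N] c_def sum_distrib_left sum.distrib[symmetric]
          algebra_simps del: sum_mult_indicator)
    also have "step_function N p (\<lambda>j. step_function n q d (p (Suc j))) s = step_function n q d s"
      by (rule step_function_refine[symmetric]) (use p assms in auto)
    also have "step_function N p (\<lambda>j. step_function m r e (p (Suc j))) s = step_function m r e s"
      by (rule step_function_refine[symmetric]) (use p assms in auto)
    finally show "step_function N p c s = a * step_function n q d s + b * step_function m r e s" .
  qed
  moreover have "step_wiener_integral W N p c =
    (\<lambda>\<omega>. a * step_wiener_integral W n q d \<omega> + b * step_wiener_integral W m r e \<omega>)"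
  proof
    fix \<omega>
    have "step_wiener_integral W N p c \<omega> = a * step_wiener_integral W N p (\<lambda>j. step_function n q d (p (Suc j))) \<omega>
        + b * step_wiener_integral W N p (\<lambda>j. step_function m r e (p (Suc j))) \<omega>"
      by (simp add: step_wiener_integral_def[of W N] c_def sum_distrib_left sum.distrib[symmetric] algebra_simps)
    also have "step_wiener_integral W N p (\<lambda>j. step_function n q d (p (Suc j))) \<omega> = step_wiener_integral W n q d \<omega>"
      by (rule step_wiener_integral_refine[symmetric]) (use p assms in auto)
    also have "step_wiener_integral W N p (\<lambda>j. step_function m r e (p (Suc j))) \<omega> = step_wiener_integral W m r e \<omega>"
      by (rule step_wiener_integral_refine[symmetric]) (use p assms in auto)
    finally show "step_wiener_integral W N p c \<omega> =
      a * step_wiener_integral W n q d \<omega> + b * step_wiener_integral W m r e \<omega>" .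
  qed
  ultimately show ?thesis using p(1) \<open>0 \<le> p 0\<close> by blast
qed

text \<open>Unlike in \<^const>\<open>has_wiener_integral\<close>, the integrand lives on the whole line and the partitions are
  strict, so that integrals over different time intervals can be combined linearly.\<close>

definition wiener_limit :: "'a measure \<Rightarrow> (real \<Rightarrow> 'a \<Rightarrow> real) \<Rightarrow> (real \<Rightarrow> real) \<Rightarrow> ('a \<Rightarrow> real) \<Rightarrow> bool" where
  "wiener_limit M W F Z \<longleftrightarrow> F \<in> borel_measurable borel \<and> Z \<in> borel_measurable M \<and>
    (\<exists>n p c.
      (\<forall>k. strict_mono_on {..n k} (p k) \<and> 0 \<le> p k 0) \<and>
      (\<lambda>k. \<integral>\<^sup>+ s. ennreal ((F s - step_function (n k) (p k) (c k) s)\<^sup>2) \<partial>lborel) \<longlonglongrightarrow> 0 \<and>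
      (\<lambda>k. \<integral>\<^sup>+ \<omega>. ennreal ((Z \<omega> - step_wiener_integral W (n k) (p k) (c k) \<omega>)\<^sup>2) \<partial>M) \<longlonglongrightarrow> 0)"

lemma has_wiener_integral_imp_wiener_limit:
  assumes "has_wiener_integral M W T f Z"
  shows "wiener_limit M W (\<lambda>s. indicator {0..T} s * f s) Z"
proof -
  from assms obtain n p c where part: "\<And>k. partition_in T (n k) (p k)"
    and f: "(\<lambda>k. \<integral>\<^sup>+ s\<in>{0..T}. ennreal ((f s - step_function (n k) (p k) (c k) s)\<^sup>2) \<partial>lborel) \<longlonglongrightarrow> 0"
    and Z: "(\<lambda>k. \<integral>\<^sup>+ \<omega>. ennreal ((Z \<omega> - step_wiener_integral W (n k) (p k) (c k) \<omega>)\<^sup>2) \<partial>M) \<longlonglongrightarrow> 0"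
    unfolding has_wiener_integral_def by blast
  have meas: "(\<lambda>s. indicator {0..T} s * f s) \<in> borel_measurable borel" "Z \<in> borel_measurable M"
    using assms by (auto simp: has_wiener_integral_def set_borel_measurable_def)
  \<comment> \<open>All partition points lie in \<open>{0..T}\<close>, so the approximants vanish
    outside and the squared distance over \<open>{0..T}\<close> equals that over the whole line to
    the truncated integrand.\<close>
  have supp: "step_function (n k) (p k) (c k) s = 0" if s: "s \<notin> {0..T}" for k s
  proof -
    have mono: "p k i \<le> p k j" if "i \<le> j" "j \<le> n k" for i j
      using that part[of k] unfolding partition_in_def
      by (induction rule: dec_induct) (auto intro: order_trans)
    have "indicator {p k i<..p k (Suc i)} s = (0::real)" if "i < n k" for i
      using s mono[of 0 i] mono[of "Suc i" "n k"] that part[of k] by (auto simp: partition_in_def indicator_def)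
    then show ?thesis unfolding step_function_def by (intro sum.neutral) simp
  qed
  \<comment> \<open>The coefficients 1 and 0 make the combination trivial; only the passage to a
    strict grid matters here.\<close>
  have "\<exists>N p' c'. strict_mono_on {..N} p' \<and> 0 \<le> p' 0 \<and>
      step_function N p' c' = step_function (n k) (p k) (c k) \<and>
      step_wiener_integral W N p' c' = step_wiener_integral W (n k) (p k) (c k)" for k
    using step_combination_grid[of "p k" "n k" "p k" "n k" 1 "c k" 0 "c k" W] part[of k]
    by (simp add: partition_in_def)
  then obtain N p' c' where grid: "\<And>k. strict_mono_on {..N k} (p' k) \<and> 0 \<le> p' k 0 \<and>
      step_function (N k) (p' k) (c' k) = step_function (n k) (p k) (c k) \<and>
      step_wiener_integral W (N k) (p' k) (c' k) = step_wiener_integral W (n k) (p k) (c k)"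
    by metis
  have "(\<integral>\<^sup>+ s\<in>{0..T}. ennreal ((f s - step_function (n k) (p k) (c k) s)\<^sup>2) \<partial>lborel)
      = (\<integral>\<^sup>+ s. ennreal ((indicator {0..T} s * f s - step_function (n k) (p k) (c k) s)\<^sup>2) \<partial>lborel)" for k
    by (intro nn_integral_cong) (auto simp: indicator_def supp)
  with f have "(\<lambda>k. \<integral>\<^sup>+ s. ennreal ((indicator {0..T} s * f s - step_function (n k) (p k) (c k) s)\<^sup>2) \<partial>lborel) \<longlonglongrightarrow> 0"
    by simp
  then show ?thesis unfolding wiener_limit_def using meas Z grid
    by (intro conjI exI[of _ N] exI[of _ p'] exI[of _ c']) auto
qed

text \<open>The factor 2 is lossy, but the estimate serves only where the right-hand side tends to 0
  or where an unspecified constant is wanted.\<close>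

lemma nn_integral_square_combination_le:
  fixes f g :: "'a \<Rightarrow> real"
  assumes [measurable]: "f \<in> borel_measurable M" "g \<in> borel_measurable M"
  shows "(\<integral>\<^sup>+ x. ennreal ((a * f x + b * g x)\<^sup>2) \<partial>M) \<le>
    ennreal (2 * a\<^sup>2) * (\<integral>\<^sup>+ x. ennreal ((f x)\<^sup>2) \<partial>M) + ennreal (2 * b\<^sup>2) * (\<integral>\<^sup>+ x. ennreal ((g x)\<^sup>2) \<partial>M)"
proof -
  have "(a * f x + b * g x)\<^sup>2 \<le> 2 * a\<^sup>2 * (f x)\<^sup>2 + 2 * b\<^sup>2 * (g x)\<^sup>2" for x
    using zero_le_power2[of "a * f x - b * g x"] by (simp add: power2_eq_square algebra_simps)
  then have "(\<integral>\<^sup>+ x. ennreal ((a * f x + b * g x)\<^sup>2) \<partial>M) \<le>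
      (\<integral>\<^sup>+ x. ennreal (2 * a\<^sup>2) * ennreal ((f x)\<^sup>2) + ennreal (2 * b\<^sup>2) * ennreal ((g x)\<^sup>2) \<partial>M)"
    by (intro nn_integral_mono) (simp add: ennreal_mult[symmetric] ennreal_plus[symmetric] del: ennreal_plus)
  also have "\<dots> = ennreal (2 * a\<^sup>2) * (\<integral>\<^sup>+ x. ennreal ((f x)\<^sup>2) \<partial>M) + ennreal (2 * b\<^sup>2) * (\<integral>\<^sup>+ x. ennreal ((g x)\<^sup>2) \<partial>M)"
    by (simp add: nn_integral_add nn_integral_cmult)
  finally show ?thesis .
qed

section \<open>Linearity, isometry and tail bound for Wiener integrals\<close>

context wiener_process
begin

lemma strict_grid_measurable:
  assumes "strict_mono_on {..N} p" "0 \<le> p 0"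
  shows "step_wiener_integral W N p c \<in> borel_measurable M"
proof (rule step_wiener_integral_measurable)
  fix i assume "i \<le> N"
  then have "p 0 \<le> p i"
    using assms(1) by (cases "i = 0") (auto simp: strict_mono_on_def intro!: less_imp_le)
  then show "0 \<le> p i" using assms(2) by simp
qed

text \<open>Linearity is what puts increments of the process between two times within reach of the
  isometry and of the tail bound.\<close>

lemma wiener_limit_combination:
  assumes "wiener_limit M W F Y" "wiener_limit M W G Z"
  shows "wiener_limit M W (\<lambda>s. a * F s + b * G s) (\<lambda>\<omega>. a * Y \<omega> + b * Z \<omega>)"
proof -
  from assms(1) obtain n p c where 1: "\<And>k. strict_mono_on {..n k} (p k)" "\<And>k. 0 \<le> p k 0"
      "(\<lambda>k. \<integral>\<^sup>+ s. ennreal ((F s - step_function (n k) (p k) (c k) s)\<^sup>2) \<partial>lborel) \<longlonglongrightarrow> 0"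
      "(\<lambda>k. \<integral>\<^sup>+ \<omega>. ennreal ((Y \<omega> - step_wiener_integral W (n k) (p k) (c k) \<omega>)\<^sup>2) \<partial>M) \<longlonglongrightarrow> 0"
    unfolding wiener_limit_def by blast
  from assms(2) obtain m q d where 2: "\<And>k. strict_mono_on {..m k} (q k)" "\<And>k. 0 \<le> q k 0"
      "(\<lambda>k. \<integral>\<^sup>+ s. ennreal ((G s - step_function (m k) (q k) (d k) s)\<^sup>2) \<partial>lborel) \<longlonglongrightarrow> 0"
      "(\<lambda>k. \<integral>\<^sup>+ \<omega>. ennreal ((Z \<omega> - step_wiener_integral W (m k) (q k) (d k) \<omega>)\<^sup>2) \<partial>M) \<longlonglongrightarrow> 0"
    unfolding wiener_limit_def by blast
  have [measurable]: "F \<in> borel_measurable borel" "G \<in> borel_measurable borel"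
      "Y \<in> borel_measurable M" "Z \<in> borel_measurable M"
    using assms by (auto simp: wiener_limit_def)
  have [measurable]: "step_wiener_integral W (n k) (p k) (c k) \<in> borel_measurable M"
     "step_wiener_integral W (m k) (q k) (d k) \<in> borel_measurable M" for k
    using strict_grid_measurable 1(1,2) 2(1,2) by auto
  have "\<exists>N r e. strict_mono_on {..N} r \<and> 0 \<le> r 0 \<and>
      step_function N r e = (\<lambda>s. a * step_function (n k) (p k) (c k) s + b * step_function (m k) (q k) (d k) s) \<and>
      step_wiener_integral W N r e = (\<lambda>\<omega>. a * step_wiener_integral W (n k) (p k) (c k) \<omega>
        + b * step_wiener_integral W (m k) (q k) (d k) \<omega>)" for k
    using 1(1)[of k] 2(1)[of k] 1(2)[of k] 2(2)[of k]
    by (intro step_combination_grid) (auto simp: strict_mono_on_def less_imp_le)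
  then obtain N r e where grid: "\<And>k. strict_mono_on {..N k} (r k) \<and> 0 \<le> r k 0 \<and>
      step_function (N k) (r k) (e k) = (\<lambda>s. a * step_function (n k) (p k) (c k) s + b * step_function (m k) (q k) (d k) s) \<and>
      step_wiener_integral W (N k) (r k) (e k) = (\<lambda>\<omega>. a * step_wiener_integral W (n k) (p k) (c k) \<omega>
        + b * step_wiener_integral W (m k) (q k) (d k) \<omega>)"
    by metis
  have split: "a * x + b * y - (a * u + b * v) = a * (x - u) + b * (y - v)" for x y u v :: real
    by (simp add: algebra_simps)
  have lim0: "h \<longlonglongrightarrow> 0" if "u \<longlonglongrightarrow> 0" "v \<longlonglongrightarrow> 0"
      "\<And>k. h k \<le> ennreal (2 * a\<^sup>2) * u k + ennreal (2 * b\<^sup>2) * v k" for h u v :: "nat \<Rightarrow> ennreal"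
  proof (rule tendsto_sandwich[OF _ _ tendsto_const])
    have "(\<lambda>k. ennreal (2 * a\<^sup>2) * u k + ennreal (2 * b\<^sup>2) * v k) \<longlonglongrightarrow> ennreal (2 * a\<^sup>2) * 0 + ennreal (2 * b\<^sup>2) * 0"
      using that by (intro tendsto_add ennreal_tendsto_cmult) auto
    then show "(\<lambda>k. ennreal (2 * a\<^sup>2) * u k + ennreal (2 * b\<^sup>2) * v k) \<longlonglongrightarrow> 0" by simp
  qed (use that in auto)
  have "(\<lambda>k. \<integral>\<^sup>+ s. ennreal ((a * F s + b * G s - step_function (N k) (r k) (e k) s)\<^sup>2) \<partial>lborel) \<longlonglongrightarrow> 0"
  proof (rule lim0[OF 1(3) 2(3)])
    fix k
    show "(\<integral>\<^sup>+ s. ennreal ((a * F s + b * G s - step_function (N k) (r k) (e k) s)\<^sup>2) \<partial>lborel) \<le>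
      ennreal (2 * a\<^sup>2) * (\<integral>\<^sup>+ s. ennreal ((F s - step_function (n k) (p k) (c k) s)\<^sup>2) \<partial>lborel) +
      ennreal (2 * b\<^sup>2) * (\<integral>\<^sup>+ s. ennreal ((G s - step_function (m k) (q k) (d k) s)\<^sup>2) \<partial>lborel)"
      using grid[of k] by (simp add: split, intro nn_integral_square_combination_le) auto
  qed
  moreover have "(\<lambda>k. \<integral>\<^sup>+ \<omega>. ennreal ((a * Y \<omega> + b * Z \<omega> - step_wiener_integral W (N k) (r k) (e k) \<omega>)\<^sup>2) \<partial>M) \<longlonglongrightarrow> 0"
  proof (rule lim0[OF 1(4) 2(4)])
    fix k
    show "(\<integral>\<^sup>+ \<omega>. ennreal ((a * Y \<omega> + b * Z \<omega> - step_wiener_integral W (N k) (r k) (e k) \<omega>)\<^sup>2) \<partial>M) \<le>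
      ennreal (2 * a\<^sup>2) * (\<integral>\<^sup>+ \<omega>. ennreal ((Y \<omega> - step_wiener_integral W (n k) (p k) (c k) \<omega>)\<^sup>2) \<partial>M) +
      ennreal (2 * b\<^sup>2) * (\<integral>\<^sup>+ \<omega>. ennreal ((Z \<omega> - step_wiener_integral W (m k) (q k) (d k) \<omega>)\<^sup>2) \<partial>M)"
      using grid[of k] by (simp add: split, intro nn_integral_square_combination_le) auto
  qed
  ultimately show ?thesis unfolding wiener_limit_def using grid
    by (intro conjI exI[of _ N] exI[of _ r] exI[of _ e]) auto
qed

lemma wiener_limit_isometry:
  assumes "wiener_limit M W F Z"
  shows "(\<integral>\<^sup>+ \<omega>. ennreal ((Z \<omega>)\<^sup>2) \<partial>M) = (\<integral>\<^sup>+ s. ennreal ((F s)\<^sup>2) \<partial>lborel)"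
proof -
  from assms obtain n p c where 1: "\<And>k. strict_mono_on {..n k} (p k)" "\<And>k. 0 \<le> p k 0"
      "(\<lambda>k. \<integral>\<^sup>+ s. ennreal ((F s - step_function (n k) (p k) (c k) s)\<^sup>2) \<partial>lborel) \<longlonglongrightarrow> 0"
      "(\<lambda>k. \<integral>\<^sup>+ \<omega>. ennreal ((Z \<omega> - step_wiener_integral W (n k) (p k) (c k) \<omega>)\<^sup>2) \<partial>M) \<longlonglongrightarrow> 0"
    unfolding wiener_limit_def by blast
  have "F \<in> borel_measurable borel" "Z \<in> borel_measurable M"
    using assms by (auto simp: wiener_limit_def)
  moreover have "step_wiener_integral W (n k) (p k) (c k) \<in> borel_measurable M" for k
    using strict_grid_measurable 1(1,2) by auto
  moreover have "(\<integral>\<^sup>+ \<omega>. ennreal ((step_wiener_integral W (n k) (p k) (c k) \<omega>)\<^sup>2) \<partial>M) =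
    (\<integral>\<^sup>+ s. ennreal ((step_function (n k) (p k) (c k) s)\<^sup>2) \<partial>lborel)" for k
    using step_wiener_integral_isometry 1(1,2) by auto
  ultimately show ?thesis
    by (intro antisym nn_integral_square_limit_le[OF _ _ _ _ 1(4) 1(3)]
        nn_integral_square_limit_le[OF _ _ _ _ 1(3) 1(4)]) auto
qed

text \<open>Some step function has squared distance less than 1 from \<open>F\<close>, and step
  functions have finite norm.\<close>

lemma wiener_limit_square_integrable:
  assumes "wiener_limit M W F Z"
  shows "(\<integral>\<^sup>+ s. ennreal ((F s)\<^sup>2) \<partial>lborel) < \<infinity>"
proof -
  from assms obtain n p c where 1: "\<And>k. strict_mono_on {..n k} (p k)"
      "(\<lambda>k. \<integral>\<^sup>+ s. ennreal ((F s - step_function (n k) (p k) (c k) s)\<^sup>2) \<partial>lborel) \<longlonglongrightarrow> 0"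
    unfolding wiener_limit_def by blast
  have [measurable]: "F \<in> borel_measurable borel" using assms by (auto simp: wiener_limit_def)
  have "eventually (\<lambda>k. (\<integral>\<^sup>+ s. ennreal ((F s - step_function (n k) (p k) (c k) s)\<^sup>2) \<partial>lborel) < 1) sequentially"
    by (rule order_tendstoD(2)[OF 1(2)]) simp
  then obtain k where k: "(\<integral>\<^sup>+ s. ennreal ((F s - step_function (n k) (p k) (c k) s)\<^sup>2) \<partial>lborel) < 1"
    by (auto simp: eventually_sequentially)
  have "(\<integral>\<^sup>+ s. ennreal ((F s)\<^sup>2) \<partial>lborel) \<le>
      ennreal (1 + 1) * (\<integral>\<^sup>+ s. ennreal ((step_function (n k) (p k) (c k) s)\<^sup>2) \<partial>lborel) +
      ennreal (1 + 1 / 1) * (\<integral>\<^sup>+ s. ennreal ((F s - step_function (n k) (p k) (c k) s)\<^sup>2) \<partial>lborel)"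
    by (rule nn_integral_square_le) auto
  also have "\<dots> < \<infinity>"
    using order_less_trans[OF k ennreal_one_less_top]
    by (simp add: nn_integral_step_function_square[OF 1(1)] ennreal_mult_less_top ennreal_add_less_top)
  finally show ?thesis .
qed

text \<open>If \<open>y \<le> \<bar>Z\<bar>\<close>, then either the approximant reaches
  \<open>y - d\<close> in absolute value or it differs from \<open>Z\<close> by at least
  \<open>d\<close>. The second event disappears in the limit by Markov's inequality; the first has a
  Gaussian bound with \<open>w\<close>, because the strict inequality in the hypothesis leaves room
  for the approximants to have variance at most \<open>w\<close> eventually. Finally
  \<open>d\<close> tends to 0.\<close>

lemma wiener_limit_tail:
  assumes lim: "wiener_limit M W F Z" and less: "(\<integral>\<^sup>+ s. ennreal ((F s)\<^sup>2) \<partial>lborel) < ennreal w"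
    and y: "0 \<le> y"
  shows "prob {\<omega> \<in> space M. y \<le> \<bar>Z \<omega>\<bar>} \<le> 2 * exp (- y\<^sup>2 / (2 * w))"
proof (cases "y = 0")
  case True
  then show ?thesis by (auto intro: order_trans[OF prob_le_1])
next
  case False
  with y have y0: "0 < y" by simp
  have w: "0 < w" using less by (metis ennreal_neg not_less_zero not_le)
  from lim obtain n p c where 1: "\<And>k. strict_mono_on {..n k} (p k)" "\<And>k. 0 \<le> p k 0"
      "(\<lambda>k. \<integral>\<^sup>+ s. ennreal ((F s - step_function (n k) (p k) (c k) s)\<^sup>2) \<partial>lborel) \<longlonglongrightarrow> 0"
      "(\<lambda>k. \<integral>\<^sup>+ \<omega>. ennreal ((Z \<omega> - step_wiener_integral W (n k) (p k) (c k) \<omega>)\<^sup>2) \<partial>M) \<longlonglongrightarrow> 0"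
    unfolding wiener_limit_def by blast
  define f where "f k = step_function (n k) (p k) (c k)" for k
  define S where "S k = step_wiener_integral W (n k) (p k) (c k)" for k
  have [measurable]: "F \<in> borel_measurable borel" "Z \<in> borel_measurable M"
    using lim by (auto simp: wiener_limit_def)
  have [measurable]: "S k \<in> borel_measurable M" "f k \<in> borel_measurable borel" for k
    unfolding S_def f_def using strict_grid_measurable 1(1,2) by auto
  define A where "A = (\<integral>\<^sup>+ s. ennreal ((F s)\<^sup>2) \<partial>lborel)"
  obtain r where r: "A = ennreal r" "0 \<le> r" "r < w"
    using less unfolding A_def[symmetric] by (cases A) (auto simp: ennreal_less_iff)
  have ev: "eventually (\<lambda>k. (\<integral>\<^sup>+ s. ennreal ((f k s)\<^sup>2) \<partial>lborel) \<le> ennreal w) sequentially"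
  proof -
    \<comment> \<open>Chosen so that \<open>(1 + e) * r < w\<close>; the denominator contains
      \<open>r + 1\<close> to stay positive when \<open>r = 0\<close>.\<close>
    define e where "e = (w - r) / (2 * (r + 1))"
    have e: "0 < e" using r by (simp add: e_def)
    have "e * (r + 1) = (w - r) / 2" using r by (simp add: e_def field_simps)
    then have "e * r < w - r" using e r by (simp add: algebra_simps)
    then have lt: "(1 + e) * r < w" by (simp add: algebra_simps)
    have "(\<lambda>k. ennreal (1 + e) * A + ennreal (1 + 1 / e) * (\<integral>\<^sup>+ s. ennreal ((F s - f k s)\<^sup>2) \<partial>lborel))
        \<longlonglongrightarrow> ennreal (1 + e) * A + ennreal (1 + 1 / e) * 0"
      unfolding f_def by (intro tendsto_add tendsto_const ennreal_tendsto_cmult 1) auto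
    moreover have "ennreal (1 + e) * A + ennreal (1 + 1 / e) * 0 < ennreal w"
    proof -
      have "ennreal (1 + e) * A + ennreal (1 + 1 / e) * 0 = ennreal ((1 + e) * r)"
        using r e by (simp add: ennreal_mult del: ennreal_plus)
      also have "\<dots> < ennreal w" using lt r e by (subst ennreal_less_iff) auto
      finally show ?thesis .
    qed
    ultimately have "eventually (\<lambda>k. ennreal (1 + e) * A + ennreal (1 + 1 / e) * (\<integral>\<^sup>+ s. ennreal ((F s - f k s)\<^sup>2) \<partial>lborel) < ennreal w) sequentially"
      by (rule order_tendstoD)
    then show ?thesis
    proof eventually_elim
      case (elim k)
      have "(\<integral>\<^sup>+ s. ennreal ((f k s)\<^sup>2) \<partial>lborel) \<le> ennreal (1 + e) * A + ennreal (1 + 1 / e) * (\<integral>\<^sup>+ s. ennreal ((F s - f k s)\<^sup>2) \<partial>lborel)"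
        unfolding A_def power2_commute[of "F _"] using e by (intro nn_integral_square_le) auto
      also note order.strict_implies_order[OF elim]
      finally show ?case .
    qed
  qed
  have bound: "prob {\<omega> \<in> space M. y \<le> \<bar>Z \<omega>\<bar>} \<le> 2 * exp (- (y - d)\<^sup>2 / (2 * w))" if d: "0 < d" "d < y" for d
  proof -
    have "eventually (\<lambda>k. emeasure M {\<omega> \<in> space M. y \<le> \<bar>Z \<omega>\<bar>} \<le> ennreal (2 * exp (- (y - d)\<^sup>2 / (2 * w))) +
        ennreal (1 / d\<^sup>2) * (\<integral>\<^sup>+ \<omega>. ennreal ((Z \<omega> - S k \<omega>)\<^sup>2) \<partial>M)) sequentially"
      using ev
    proof eventually_elim
      case (elim k)
      \<comment> \<open>The event that \<open>Z\<close> and \<open>S k\<close> differ by at least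
        \<open>d\<close> is written with a multiple that reaches 1, the form in which Markov's
        inequality for nonnegative integrals applies.\<close>
      have "emeasure M {\<omega> \<in> space M. y \<le> \<bar>Z \<omega>\<bar>} \<le>
          emeasure M ({\<omega> \<in> space M. y - d \<le> \<bar>S k \<omega>\<bar>} \<union>
            {\<omega> \<in> space M. 1 \<le> ennreal (1 / d\<^sup>2) * ennreal ((Z \<omega> - S k \<omega>)\<^sup>2)})"
      proof (rule emeasure_mono)
        show "{\<omega> \<in> space M. y \<le> \<bar>Z \<omega>\<bar>} \<subseteq> {\<omega> \<in> space M. y - d \<le> \<bar>S k \<omega>\<bar>} \<union>
            {\<omega> \<in> space M. 1 \<le> ennreal (1 / d\<^sup>2) * ennreal ((Z \<omega> - S k \<omega>)\<^sup>2)}"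
        proof
          fix \<omega> assume \<omega>: "\<omega> \<in> {\<omega> \<in> space M. y \<le> \<bar>Z \<omega>\<bar>}"
          show "\<omega> \<in> {\<omega> \<in> space M. y - d \<le> \<bar>S k \<omega>\<bar>} \<union>
            {\<omega> \<in> space M. 1 \<le> ennreal (1 / d\<^sup>2) * ennreal ((Z \<omega> - S k \<omega>)\<^sup>2)}"
          proof (cases "y - d \<le> \<bar>S k \<omega>\<bar>")
            case True
            then show ?thesis using \<omega> by auto
          next
            case False
            then have "d \<le> \<bar>Z \<omega> - S k \<omega>\<bar>" using \<omega> by auto
            then have "d\<^sup>2 \<le> (Z \<omega> - S k \<omega>)\<^sup>2" using d by (metis abs_le_square_iff abs_of_pos)
            then have "1 \<le> 1 / d\<^sup>2 * (Z \<omega> - S k \<omega>)\<^sup>2" using d by simp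
            then have "1 \<le> ennreal (1 / d\<^sup>2) * ennreal ((Z \<omega> - S k \<omega>)\<^sup>2)"
              by (subst ennreal_mult[symmetric]) (simp_all only: ennreal_1[symmetric] ennreal_leI, simp_all)
            then show ?thesis using \<omega> by auto
          qed
        qed
      qed measurable
      also have "\<dots> \<le> emeasure M {\<omega> \<in> space M. y - d \<le> \<bar>S k \<omega>\<bar>} +
            emeasure M {\<omega> \<in> space M. 1 \<le> ennreal (1 / d\<^sup>2) * ennreal ((Z \<omega> - S k \<omega>)\<^sup>2)}"
        by (rule emeasure_subadditive) measurable
      also have "\<dots> \<le> ennreal (2 * exp (- (y - d)\<^sup>2 / (2 * w))) +
          ennreal (1 / d\<^sup>2) * (\<integral>\<^sup>+ \<omega>. ennreal ((Z \<omega> - S k \<omega>)\<^sup>2) * indicator (space M) \<omega> \<partial>M)"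
      proof (rule add_mono)
        show "emeasure M {\<omega> \<in> space M. y - d \<le> \<bar>S k \<omega>\<bar>} \<le> ennreal (2 * exp (- (y - d)\<^sup>2 / (2 * w)))"
          unfolding emeasure_eq_measure S_def
          using elim d by (intro ennreal_leI step_wiener_integral_tail 1 w) (auto simp: f_def)
      qed (rule nn_integral_Markov_inequality, auto)
      also have "(\<integral>\<^sup>+ \<omega>. ennreal ((Z \<omega> - S k \<omega>)\<^sup>2) * indicator (space M) \<omega> \<partial>M) = (\<integral>\<^sup>+ \<omega>. ennreal ((Z \<omega> - S k \<omega>)\<^sup>2) \<partial>M)"
        by (intro nn_integral_cong) simp
      finally show ?case .
    qed
    moreover have "(\<lambda>k. ennreal (2 * exp (- (y - d)\<^sup>2 / (2 * w))) +
        ennreal (1 / d\<^sup>2) * (\<integral>\<^sup>+ \<omega>. ennreal ((Z \<omega> - S k \<omega>)\<^sup>2) \<partial>M)) \<longlonglongrightarrow>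
        ennreal (2 * exp (- (y - d)\<^sup>2 / (2 * w))) + ennreal (1 / d\<^sup>2) * 0"
      unfolding S_def by (intro tendsto_add tendsto_const ennreal_tendsto_cmult 1) auto
    ultimately have "emeasure M {\<omega> \<in> space M. y \<le> \<bar>Z \<omega>\<bar>} \<le> ennreal (2 * exp (- (y - d)\<^sup>2 / (2 * w))) + ennreal (1 / d\<^sup>2) * 0"
      by (intro tendsto_lowerbound[where F=sequentially]) auto
    then show ?thesis by (simp add: emeasure_eq_measure)
  qed
  have "((\<lambda>d. 2 * exp (- (y - d)\<^sup>2 / (2 * w))) \<longlongrightarrow> 2 * exp (- (y - 0)\<^sup>2 / (2 * w))) (at_right 0)"
    using w by (intro tendsto_intros) auto
  moreover have "eventually (\<lambda>d. prob {\<omega> \<in> space M. y \<le> \<bar>Z \<omega>\<bar>} \<le> 2 * exp (- (y - d)\<^sup>2 / (2 * w))) (at_right 0)"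
    using eventually_at_right_real[OF y0] by eventually_elim (use bound in auto)
  ultimately have "prob {\<omega> \<in> space M. y \<le> \<bar>Z \<omega>\<bar>} \<le> 2 * exp (- (y - 0)\<^sup>2 / (2 * w))"
    by (intro tendsto_lowerbound[where F="at_right (0::real)"]) auto
  then show ?thesis by simp
qed

end

section \<open>An upper bound of iterated logarithm type\<close>

text \<open>The point \<open>t\<close> is approached from the left by dyadic points, one per level.
  Consecutive ones coincide or are neighbours on the finer level, so the moves sum to at most a
  geometric series, and continuity carries the bound over to \<open>t\<close>.\<close>

lemma dyadic_chaining:
  fixes f :: "real \<Rightarrow> real"
  assumes cont: "continuous_on {a..a + h} f" and h: "0 < h" and r: "0 \<le> r" "r < 1"
    and step: "\<And>m k. k < 2 ^ m \<Longrightarrow> \<bar>f (a + real k * (h / 2 ^ m) + h / 2 ^ m) - f (a + real k * (h / 2 ^ m))\<bar> \<le> r ^ m"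
    and t: "a \<le> t" "t < a + h"
  shows "\<bar>f t - f a\<bar> \<le> 1 / (1 - r)"
proof -
  define \<theta> where "\<theta> = (t - a) / h"
  have \<theta>: "0 \<le> \<theta>" "\<theta> < 1" "t = a + \<theta> * h" using t h by (auto simp: \<theta>_def field_simps)
  \<comment> \<open>Index of the left end point of the level \<open>m\<close> dyadic interval that
    contains \<open>t\<close>.\<close>
  define K where "K m = nat \<lfloor>\<theta> * 2 ^ m\<rfloor>" for m :: nat
  define x where "x m = a + real (K m) * (h / 2 ^ m)" for m
  have K: "real (K m) \<le> \<theta> * 2 ^ m" "\<theta> * 2 ^ m < real (K m) + 1" for m
    using \<theta> unfolding K_def by (auto simp: of_nat_nat)
  have x_le: "x m \<le> t" "t - h / 2 ^ m \<le> x m" for m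
  proof -
    have "real (K m) * (h / 2 ^ m) \<le> \<theta> * 2 ^ m * (h / 2 ^ m)"
      using K h by (intro mult_right_mono) auto
    then show "x m \<le> t" using \<theta>(3) by (simp add: x_def)
    have "\<theta> * 2 ^ m * (h / 2 ^ m) \<le> (real (K m) + 1) * (h / 2 ^ m)"
      using K[of m] h by (intro mult_right_mono) auto
    then have "\<theta> * h \<le> real (K m) * (h / 2 ^ m) + h / 2 ^ m"
      by (simp add: distrib_right add_divide_distrib)
    then show "t - h / 2 ^ m \<le> x m" using \<theta>(3) unfolding x_def by linarith
  qed
  have bound: "\<bar>f (x m) - f a\<bar> \<le> (\<Sum>j\<le>m. r ^ j)" for m
  proof (induction m)
    case 0
    have "K 0 = 0" using K(1)[of 0] \<theta> by simp
    then show ?case by (simp add: x_def)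
  next
    case (Suc m)
    have lo: "2 * real (K m) < real (K (Suc m)) + 1" using K[of m] K[of "Suc m"] by simp
    have hi: "real (K (Suc m)) < 2 * real (K m) + 2" using K[of m] K[of "Suc m"] by simp
    \<comment> \<open>Doubling a real number doubles its integer part or adds one more, so the
      approximation stays put or moves one step to the right.\<close>
    have cases: "K (Suc m) = 2 * K m \<or> K (Suc m) = 2 * K m + 1" using lo hi by linarith
    define c where "c = h / 2 ^ Suc m"
    have xm: "x m = a + real (2 * K m) * c" by (simp add: x_def c_def)
    have xS: "x (Suc m) = a + real (K (Suc m)) * c" by (simp only: x_def c_def)
    have "\<bar>f (x (Suc m)) - f (x m)\<bar> \<le> r ^ Suc m"
      using cases
    proof
      assume "K (Suc m) = 2 * K m"
      then have "x (Suc m) = x m" by (simp only: xm xS)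
      then show ?thesis using r by simp
    next
      assume k: "K (Suc m) = 2 * K m + 1"
      have "\<theta> * 2 ^ Suc m < 1 * 2 ^ Suc m" using \<theta> by (intro mult_strict_right_mono) auto
      with K(1)[of "Suc m"] have "real (K (Suc m)) < 2 ^ Suc m" by linarith
      then have "real (K (Suc m)) < real (2 ^ Suc m)" by simp
      then have "K (Suc m) < 2 ^ Suc m" by (simp only: of_nat_less_iff)
      \<comment> \<open>The increment starts at index \<open>2 * K m\<close> and ends at
        \<open>K (Suc m)\<close>. It is among the controlled ones because \<open>t < a + h\<close>
        keeps \<open>K (Suc m)\<close> below \<open>2 ^ Suc m\<close>.\<close>
      then have lt: "2 * K m < 2 ^ Suc m" using k by linarith
      have "x (Suc m) = a + real (2 * K m) * c + c"
        unfolding xS k by (simp add: algebra_simps)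
      then show ?thesis using step[OF lt, folded c_def] xm by simp
    qed
    with Suc show ?case by simp
  qed
  have geo: "(\<Sum>j\<le>m. r ^ j) \<le> 1 / (1 - r)" for m
  proof -
    have "(\<Sum>j\<le>m. r ^ j) = (1 - r ^ Suc m) / (1 - r)"
      using r by (simp add: sum_gp0)
    also have "\<dots> \<le> 1 / (1 - r)" using r by (intro divide_right_mono) auto
    finally show ?thesis .
  qed
  have "x \<longlonglongrightarrow> t"
  proof (rule tendsto_sandwich[where f="\<lambda>m. t - h / 2 ^ m" and h="\<lambda>_. t"])
    have "(\<lambda>m. t - h * (1 / 2) ^ m) \<longlonglongrightarrow> t - h * 0"
      by (intro tendsto_intros LIMSEQ_realpow_zero) auto
    then show "(\<lambda>m. t - h / 2 ^ m) \<longlonglongrightarrow> t" by (simp add: power_divide)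
  qed (use x_le in auto)
  then have "(\<lambda>m. f (x m)) \<longlonglongrightarrow> f t"
  proof (rule continuous_on_tendsto_compose[OF cont])
    show "t \<in> {a..a + h}" using t by auto
    have "a \<le> x m" for m using h by (simp add: x_def)
    moreover have "x m \<le> a + h" for m using x_le(1)[of m] t by linarith
    ultimately show "eventually (\<lambda>m. x m \<in> {a..a + h}) sequentially"
      by (auto intro!: always_eventually)
  qed
  then have "(\<lambda>m. \<bar>f (x m) - f a\<bar>) \<longlonglongrightarrow> \<bar>f t - f a\<bar>"
    by (intro tendsto_intros)
  then show ?thesis
    by (rule LIMSEQ_le_const2) (use bound geo in \<open>blast intro: order_trans\<close>)
qed

text \<open>Rearranged from \<open>(1 + z / N) ^ N \<le> exp z\<close>. It trades the Gaussian
  exponential for a negative power of any chosen order, which the union bounds over dyadic levels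
  and over grid cells can sum.\<close>

lemma exp_minus_le_power:
  fixes z :: real
  assumes "0 < z" "0 < N"
  shows "exp (- z) \<le> (real N / z) ^ N"
proof -
  have "(z / real N) ^ N \<le> (1 + z / real N) ^ N"
    using assms by (intro power_mono) auto
  also have "\<dots> \<le> exp z"
    using assms by (intro exp_ge_one_plus_x_over_n_power_n) auto
  finally have "1 / exp z \<le> 1 / (z / real N) ^ N"
    using assms by (intro divide_left_mono) auto
  then show ?thesis using assms by (simp add: exp_minus inverse_eq_divide power_divide)
qed

text \<open>By the mean value theorem, since \<open>z powr (a - 1)\<close> decreases for
  \<open>a < 1\<close>. This is the mesh of the grid \<open>n powr a\<close>.\<close>

lemma powr_increment_le:
  fixes a :: real
  assumes "0 < a" "a < 1" "0 < n"
  shows "real (Suc n) powr a - real n powr a \<le> real n powr (a - 1)"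
proof -
  have "\<exists>z. real n < z \<and> z < real (Suc n) \<and>
      real (Suc n) powr a - real n powr a = (real (Suc n) - real n) * (a * z powr (a - 1))"
    using assms by (intro MVT2) (auto intro!: derivative_eq_intros simp: field_simps powr_diff)
  then obtain z where z: "real n < z" "real (Suc n) powr a - real n powr a = a * z powr (a - 1)" by auto
  have "a * z powr (a - 1) \<le> 1 * real n powr (a - 1)"
    using assms z by (intro mult_mono powr_mono2') auto
  then show ?thesis using z by simp
qed

section \<open>Oscillation bounds and Borel-Cantelli along a polynomial grid\<close>

context prob_space
begin

text \<open>At level \<open>m\<close> the increments have standard deviation scale
  \<open>(h / 2 ^ m) powr d\<close>, while the threshold \<open>r ^ m\<close> decays only like
  \<open>2 powr (- d * m / 2)\<close>, with half that exponent. The ratio grows geometrically in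
  \<open>m\<close>, which pays for the \<open>2 ^ m\<close> intervals, and it contains a negative
  power of \<open>h\<close>, which yields the small factor in the bound.\<close>

lemma prob_dyadic_increments:
  fixes Y :: "real \<Rightarrow> 'a \<Rightarrow> real"
  assumes meas: "\<And>u. 0 \<le> u \<Longrightarrow> Y u \<in> borel_measurable M"
    and inc: "\<And>u h y. 0 \<le> u \<Longrightarrow> 0 < h \<Longrightarrow> h \<le> 1 \<Longrightarrow> 0 \<le> y \<Longrightarrow>
      prob {\<omega> \<in> space M. y \<le> \<bar>Y (u + h) \<omega> - Y u \<omega>\<bar>} \<le> 2 * exp (- y\<^sup>2 / (2 * (C * h powr (2 * d))))"
    and C: "0 < C" and d: "0 < d" and N: "2 \<le> d * real N" and a: "0 \<le> a" and h: "0 < h" "h \<le> 1"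
  defines "r \<equiv> 2 powr (- d / 2)"
  defines "B \<equiv> {\<omega> \<in> space M. \<exists>m. \<exists>k<2 ^ m.
    r ^ m \<le> \<bar>Y (a + real k * (h / 2 ^ m) + h / 2 ^ m) \<omega> - Y (a + real k * (h / 2 ^ m)) \<omega>\<bar>}"
  shows "B \<in> sets M" and "prob B \<le> 4 * (2 * C * real N) ^ N * h powr (2 * d * real N)"
proof -
  define E where "E m k = {\<omega> \<in> space M.
    r ^ m \<le> \<bar>Y (a + real k * (h / 2 ^ m) + h / 2 ^ m) \<omega> - Y (a + real k * (h / 2 ^ m)) \<omega>\<bar>}" for m k :: nat
  have N0: "0 < N" using N d by (cases N) auto
  have [measurable]: "E m k \<in> sets M" for m k
  proof -
    have [measurable]: "Y (a + real k * (h / 2 ^ m) + h / 2 ^ m) \<in> borel_measurable M"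
      "Y (a + real k * (h / 2 ^ m)) \<in> borel_measurable M"
      using a h by (auto intro!: meas)
    show ?thesis unfolding E_def by measurable
  qed
  have B: "B = (\<Union>m. \<Union>k<2 ^ m. E m k)" unfolding B_def E_def by auto
  show "B \<in> sets M" unfolding B by measurable
  define L where "L = 2 * (2 * C * real N) ^ N * h powr (2 * d * real N)"
  have L0: "0 \<le> L" using C by (simp add: L_def)
  have E_le: "prob (E m k) \<le> L * (1 / 4) ^ m" for m k
  proof -
    define x where "x = h / 2 ^ m"
    have x: "0 < x" "x \<le> 1"
    proof -
      show "0 < x" using h by (simp add: x_def)
      have "(1::real) \<le> 2 ^ m" by simp
      with h(2) have "h \<le> 2 ^ m" by linarith
      then show "x \<le> 1" unfolding x_def by (simp add: divide_le_eq)
    qed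
    \<comment> \<open>The Gaussian exponent: squared threshold divided by twice the variance
      bound.\<close>
    define z where "z = 2 powr (d * real m) / (2 * C * h powr (2 * d))"
    have z: "0 < z" using C h by (simp add: z_def)
    have xp: "x powr (2 * d) = h powr (2 * d) * 2 powr (- 2 * d * real m)"
    proof -
      have "x = h * 2 powr (- real m)"
        unfolding x_def by (simp add: powr_minus powr_realpow divide_inverse)
      then have "x powr (2 * d) = h powr (2 * d) * (2 powr (- real m)) powr (2 * d)"
        using h by (simp add: powr_mult)
      then show ?thesis by (simp add: powr_powr mult.commute mult.left_commute)
    qed
    have rp: "(r ^ m)\<^sup>2 = 2 powr (- d * real m)"
    proof -
      have "r ^ m = r powr real m" by (rule powr_realpow[symmetric]) (simp add: r_def)
      also have "\<dots> = 2 powr (- d * real m / 2)" by (simp add: r_def powr_powr)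
      finally show ?thesis by (simp add: power2_eq_square powr_add[symmetric])
    qed
    have zz: "(r ^ m)\<^sup>2 / (2 * (C * x powr (2 * d))) = z"
    proof -
      have "2 powr (- d * real m) = 2 powr (d * real m) * 2 powr (- 2 * d * real m)"
        by (simp add: powr_add[symmetric])
      then show ?thesis unfolding rp xp z_def by simp
    qed
    have "prob (E m k) \<le> 2 * exp (- (r ^ m)\<^sup>2 / (2 * (C * x powr (2 * d))))"
      unfolding E_def x_def[symmetric] using a h x by (intro inc) (auto simp: r_def)
    also have "\<dots> = 2 * exp (- z)" using zz by simp
    also have "\<dots> \<le> 2 * (real N / z) ^ N" using exp_minus_le_power[OF z N0] by simp
    also have "real N / z = (2 * C * real N) * h powr (2 * d) * 2 powr (- d * real m)"
      unfolding z_def by (simp add: powr_minus field_simps)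
    also have "\<dots> ^ N = (2 * C * real N) ^ N * h powr (2 * d * real N) * 2 powr (- d * real m * real N)"
    proof -
      have "(b powr e) ^ N = b powr (e * real N)" if "0 < b" for b e :: real
        using powr_realpow[of "b powr e" N] that by (simp add: powr_powr)
      then show ?thesis using h by (simp add: power_mult_distrib)
    qed
    \<comment> \<open>Here \<open>2 \<le> d * real N\<close> enters: each event costs at most a
      multiple of \<open>4 ^ (-m)\<close>, so \<open>2 ^ m\<close> events together leave
      \<open>2 ^ (-m)\<close>, which sums to 2 over the levels.\<close>
    also have "2 powr (- d * real m * real N) \<le> 2 powr (- 2 * real m)"
    proof (rule powr_mono)
      have "2 * real m \<le> d * real N * real m" using N by (intro mult_right_mono) auto
      then show "- d * real m * real N \<le> - 2 * real m" by (simp add: algebra_simps)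
    qed simp
    also have "2 powr (- 2 * real m) = (1 / 4) ^ m"
    proof -
      have "2 powr (- 2 * real m) = (2 powr (- 2)) powr real m" by (simp only: powr_powr)
      also have "2 powr (- 2) = (1 / 4 :: real)" by (simp add: powr_minus)
      finally show ?thesis by (simp add: powr_realpow)
    qed
    finally show ?thesis using C by (simp add: L_def mult_left_mono mult.assoc)
  qed
  have level: "emeasure M (\<Union>k<2 ^ m. E m k) \<le> ennreal (L * (1 / 2) ^ m)" for m
  proof -
    have "prob (\<Union>k<2 ^ m. E m k) \<le> (\<Sum>k<2 ^ m. prob (E m k))"
      by (rule measure_UNION_le) auto
    also have "\<dots> \<le> (\<Sum>k<(2::nat) ^ m. L * (1 / 4) ^ m)" by (intro sum_mono E_le)
    also have "\<dots> = L * (1 / 2) ^ m"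
    proof -
      have "(2::real) ^ m * (1 / 4) ^ m = (1 / 2) ^ m" by (simp add: power_mult_distrib[symmetric])
      then show ?thesis by (simp add: algebra_simps)
    qed
    finally show ?thesis by (simp add: emeasure_eq_measure ennreal_leI)
  qed
  have "emeasure M B \<le> (\<Sum>m. emeasure M (\<Union>k<2 ^ m. E m k))"
    unfolding B by (rule emeasure_subadditive_countably) auto
  also have "\<dots> \<le> (\<Sum>m. ennreal (L * (1 / 2) ^ m))"
    by (intro suminf_le level) auto
  also have "\<dots> = ennreal (L * 2)"
  proof (rule suminf_ennreal_eq)
    show "(\<lambda>m. L * (1 / 2) ^ m) sums (L * 2)"
      using geometric_sums[of "1 / 2 :: real"] by (intro sums_mult) simp
  qed (use L0 in auto)
  finally have "prob B \<le> L * 2" using L0 by (simp add: emeasure_eq_measure)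
  then show "prob B \<le> 4 * (2 * C * real N) ^ N * h powr (2 * d * real N)" by (simp add: L_def)
qed

text \<open>The slack between \<open>sqrt v\<close> and \<open>c\<close> is spent three times: on a
  variance bound \<open>w\<close> above \<open>v\<close>, on a grid exponent below 1, and on
  absorbing the constant oscillation within a cell. The tail hypothesis ranges over all
  \<open>w > v\<close> because a limit of step integrals satisfies it only with strict room.\<close>

theorem AE_eventually_le_sqrt_ln:
  fixes Y :: "real \<Rightarrow> 'a \<Rightarrow> real"
  assumes meas: "\<And>u. 0 \<le> u \<Longrightarrow> Y u \<in> borel_measurable M"
    and tail: "\<And>w u y. v < w \<Longrightarrow> 0 \<le> u \<Longrightarrow> 0 \<le> y \<Longrightarrow>
      prob {\<omega> \<in> space M. y \<le> \<bar>Y u \<omega>\<bar>} \<le> 2 * exp (- y\<^sup>2 / (2 * w))"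
    and inc: "\<And>u h y. 0 \<le> u \<Longrightarrow> 0 < h \<Longrightarrow> h \<le> 1 \<Longrightarrow> 0 \<le> y \<Longrightarrow>
      prob {\<omega> \<in> space M. y \<le> \<bar>Y (u + h) \<omega> - Y u \<omega>\<bar>} \<le> 2 * exp (- y\<^sup>2 / (2 * (C * h powr (2 * d))))"
    and C: "0 < C" and d: "0 < d"
    and cont: "AE \<omega> in M. continuous_on {0..} (\<lambda>u. Y u \<omega>)"
    and v: "0 \<le> v" and c: "sqrt v < c"
  shows "AE \<omega> in M. eventually (\<lambda>u. \<bar>Y u \<omega>\<bar> \<le> c * sqrt (2 * ln u)) at_top"
proof -
  \<comment> \<open>\<open>c'\<close> is the constant reached at grid points; \<open>c - c'\<close>
    is kept for the oscillation between them.\<close>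
  obtain c' where c': "sqrt v < c'" "c' < c" using dense[OF c] by blast
  have "0 \<le> sqrt v" using v by simp
  then have c'0: "0 < c'" using c' by linarith
  have "(sqrt v)\<^sup>2 < c'\<^sup>2" using c' v by (intro power_strict_mono) auto
  then have "v < c'\<^sup>2" using v by simp
  then obtain w where w: "v < w" "w < c'\<^sup>2" using dense by blast
  have w0: "0 < w" using w v by simp
  have "w / c'\<^sup>2 < 1" using w c'0 by simp
  \<comment> \<open>The lower bound makes the exponent \<open>a * c'^2 / w\<close> of the grid
    series exceed 1; the upper bound makes the mesh shrink like a power of \<open>n\<close>.\<close>
  then obtain a where a: "w / c'\<^sup>2 < a" "a < 1" using dense by blast
  have a0: "0 < a" using a w0 c'0 by (meson divide_pos_pos order_less_trans zero_less_power)
  have exponent: "- (a * c'\<^sup>2 / w) < - 1" using a w0 c'0 by (simp add: field_simps)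
  define u where "u n = real n powr a" for n :: nat
  have u0: "0 \<le> u n" for n by (simp add: u_def)
  have [measurable]: "Y (u n) \<in> borel_measurable M" for n using meas u0 by blast

  define A where "A n = {\<omega> \<in> space M. c' * sqrt (2 * ln (u n)) \<le> \<bar>Y (u n) \<omega>\<bar>}" for n
  have A_sets: "A n \<in> sets M" for n unfolding A_def by measurable
  have A_le: "prob (A n) \<le> 2 * real n powr (- (a * c'\<^sup>2 / w))" if n: "0 < n" for n
  proof -
    have ln_u: "ln (u n) = a * ln (real n)" using n by (simp add: u_def ln_powr)
    have ln0: "0 \<le> ln (u n)" unfolding ln_u using n a0 by simp
    have "prob (A n) \<le> 2 * exp (- (c' * sqrt (2 * ln (u n)))\<^sup>2 / (2 * w))"
      unfolding A_def using w u0 c'0 ln0 by (intro tail) auto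
    also have "- (c' * sqrt (2 * ln (u n)))\<^sup>2 / (2 * w) = - (a * c'\<^sup>2 / w) * ln (real n)"
      using ln0 w0 ln_u by (simp add: power_mult_distrib field_simps)
    also have "exp \<dots> = real n powr (- (a * c'\<^sup>2 / w))" using n by (simp add: powr_def)
    finally show ?thesis .
  qed
  have A_sum: "summable (\<lambda>n. prob (A n))"
  proof (rule summable_comparison_test_ev)
    show "eventually (\<lambda>n. norm (prob (A n)) \<le> 2 * real n powr (- (a * c'\<^sup>2 / w))) sequentially"
      using eventually_gt_at_top[of 0] by eventually_elim (use A_le in auto)
    show "summable (\<lambda>n. 2 * real n powr (- (a * c'\<^sup>2 / w)))"
      using exponent by (intro summable_mult) (simp add: summable_real_powr_iff)
  qed

  define h where "h n = u (Suc n) - u n" for n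
  have h: "0 < h n" "h n \<le> real n powr (a - 1)" "h n \<le> 1" if n: "0 < n" for n
  proof -
    show "0 < h n" unfolding h_def u_def using n a0 by (simp add: powr_less_mono2)
    show "h n \<le> real n powr (a - 1)" unfolding h_def u_def by (rule powr_increment_le[OF a0 a(2) n])
    also have "\<dots> \<le> real n powr 0" using n a by (intro powr_mono) auto
    finally show "h n \<le> 1" using n by simp
  qed
  define r where "r = 2 powr (- d / 2)"
  have r: "0 \<le> r" "r < 1" using d by (auto simp: r_def powr_less_one)
  \<comment> \<open>The two summands secure the two requirements on \<open>N\<close>:
    \<open>2 / d\<close> for convergence over dyadic levels, the other one for convergence over grid
    cells, where the exponent of \<open>n\<close> becomes at most -2.\<close>
  obtain N :: nat where "2 / d + 1 / ((1 - a) * d) \<le> real N" using real_arch_simple by blast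
  then have N: "2 \<le> d * real N" "1 \<le> (1 - a) * (d * real N)"
  proof -
    assume le: "2 / d + 1 / ((1 - a) * d) \<le> real N"
    have p: "0 \<le> 2 / d" "0 \<le> 1 / ((1 - a) * d)" using d a by auto
    have "2 / d \<le> real N" using le p by linarith
    then show "2 \<le> d * real N" using d by (simp add: field_simps)
    have "1 / ((1 - a) * d) \<le> real N" using le p by linarith
    moreover have "0 < (1 - a) * d" using d a by simp
    ultimately show "1 \<le> (1 - a) * (d * real N)" by (simp add: pos_divide_le_eq ac_simps)
  qed
  \<comment> \<open>Cell 0 is excluded: its length is 1, whereas the mesh bound
    \<open>0 powr (a - 1)\<close> equals 0.\<close>
  define B where "B n = (if n = 0 then {} else {\<omega> \<in> space M. \<exists>m. \<exists>k<2 ^ m.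
    r ^ m \<le> \<bar>Y (u n + real k * (h n / 2 ^ m) + h n / 2 ^ m) \<omega> - Y (u n + real k * (h n / 2 ^ m)) \<omega>\<bar>})" for n
  have B: "B n \<in> sets M" "prob (B n) \<le> 4 * (2 * C * real N) ^ N * real n powr ((a - 1) * (2 * d * real N))"
    if n: "0 < n" for n
  proof -
    have B_eq: "B n = {\<omega> \<in> space M. \<exists>m. \<exists>k<2 ^ m. (2 powr (- d / 2)) ^ m \<le>
        \<bar>Y (u n + real k * (h n / 2 ^ m) + h n / 2 ^ m) \<omega> - Y (u n + real k * (h n / 2 ^ m)) \<omega>\<bar>}"
      using n by (simp add: B_def r_def)
    show "B n \<in> sets M" unfolding B_eq
      by (rule prob_dyadic_increments(1)[where Y=Y and C=C and d=d and N=N and a="u n" and h="h n",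
            OF meas inc C d N(1) u0 h(1)[OF n] h(3)[OF n]])
    have "prob (B n) \<le> 4 * (2 * C * real N) ^ N * h n powr (2 * d * real N)" unfolding B_eq
      by (rule prob_dyadic_increments(2)[where Y=Y and C=C and d=d and N=N and a="u n" and h="h n",
            OF meas inc C d N(1) u0 h(1)[OF n] h(3)[OF n]])
    also have "h n powr (2 * d * real N) \<le> (real n powr (a - 1)) powr (2 * d * real N)"
      using h[OF n] d by (intro powr_mono2) auto
    also have "\<dots> = real n powr ((a - 1) * (2 * d * real N))" by (simp add: powr_powr)
    finally show "prob (B n) \<le> 4 * (2 * C * real N) ^ N * real n powr ((a - 1) * (2 * d * real N))"
      using C by (simp add: mult_left_mono)
  qed
  have B_sets: "B n \<in> sets M" for n 
  proof (cases "n = 0")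
    case True
    then show ?thesis by (simp add: B_def)
  next
    case False
    then show ?thesis by (intro B(1)) simp
  qed
  have B_sum: "summable (\<lambda>n. prob (B n))"
  proof (rule summable_comparison_test_ev)
    show "eventually (\<lambda>n. norm (prob (B n)) \<le>
        4 * (2 * C * real N) ^ N * real n powr ((a - 1) * (2 * d * real N))) sequentially"
      using eventually_gt_at_top[of 0] by eventually_elim (use B in auto)
    have "(a - 1) * (2 * d * real N) < - 1" using N(2) by (simp add: algebra_simps)
    then show "summable (\<lambda>n. 4 * (2 * C * real N) ^ N * real n powr ((a - 1) * (2 * d * real N)))"
      by (intro summable_mult) (simp add: summable_real_powr_iff)
  qed

  have "AE \<omega> in M. eventually (\<lambda>n. \<omega> \<in> space M - A n) sequentially"
    by (rule borel_cantelli_AE1[OF A_sets _ A_sum]) (simp add: emeasure_eq_measure)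
  moreover have "AE \<omega> in M. eventually (\<lambda>n. \<omega> \<in> space M - B n) sequentially"
    by (rule borel_cantelli_AE1[OF B_sets _ B_sum]) (simp add: emeasure_eq_measure)
  ultimately show ?thesis using cont
  proof eventually_elim
    case (elim \<omega>)
    from eventually_conj[OF elim(1) elim(2)] obtain n0
      where n0: "\<And>n. n0 \<le> n \<Longrightarrow> \<omega> \<in> space M - A n \<and> \<omega> \<in> space M - B n"
      by (auto simp: eventually_sequentially)
    define D where "D = 1 / (1 - r)"
    have osc: "\<bar>Y t \<omega>\<bar> \<le> c' * sqrt (2 * ln t) + D"
      if n: "n0 \<le> n" "0 < n" and t: "u n \<le> t" "t < u (Suc n)" for n t
    proof -
      have "\<bar>Y t \<omega> - Y (u n) \<omega>\<bar> \<le> D" unfolding D_def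
      proof (rule dyadic_chaining[where f="\<lambda>t. Y t \<omega>" and a="u n" and t=t and h="h n", OF _ h(1)[OF n(2)] r])
        show "continuous_on {u n..u n + h n} (\<lambda>t. Y t \<omega>)"
          by (rule continuous_on_subset[OF elim(3)]) (use u0[of n] in auto)
        show "u n \<le> t" "t < u n + h n" using t by (auto simp: h_def)
        fix m k :: nat assume "k < 2 ^ m"
        then show "\<bar>Y (u n + real k * (h n / 2 ^ m) + h n / 2 ^ m) \<omega> - Y (u n + real k * (h n / 2 ^ m)) \<omega>\<bar> \<le> r ^ m"
          using n0[OF n(1)] n(2) by (auto simp: B_def not_le intro: less_imp_le)
      qed
      moreover have "\<bar>Y (u n) \<omega>\<bar> < c' * sqrt (2 * ln (u n))"
        using n0[OF n(1)] by (auto simp: A_def)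
      moreover have "c' * sqrt (2 * ln (u n)) \<le> c' * sqrt (2 * ln t)"
      proof -
        have "0 < u n" using n by (simp add: u_def)
        then have "ln (u n) \<le> ln t" using t by simp
        then show ?thesis using c'0 by (intro mult_left_mono) auto
      qed
      ultimately show ?thesis by linarith
    qed
    have "filterlim (\<lambda>t. sqrt (2 * ln t)) at_top (at_top :: real filter)"
      by (intro filterlim_compose[OF sqrt_at_top] filterlim_tendsto_pos_mult_at_top[OF tendsto_const] ln_at_top) auto
    \<comment> \<open>From here on \<open>(c - c') * sqrt (2 * ln t)\<close> dominates the
      oscillation bound \<open>D\<close>.\<close>
    then have "eventually (\<lambda>t. D / (c - c') \<le> sqrt (2 * ln t)) at_top"
      by (simp add: filterlim_at_top)
    then show ?case using eventually_ge_at_top[of "max 1 (real (Suc n0) powr a)"]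
    proof eventually_elim
      case (elim t)
      then have t: "1 \<le> t" "real (Suc n0) powr a \<le> t" by auto
      \<comment> \<open>Inverting \<open>n powr a\<close> locates the cell
        \<open>u n \<le> t < u (Suc n)\<close>; the bound
        \<open>real (Suc n0) powr a \<le> t\<close> then forces \<open>n0 < n\<close>, and in
        particular \<open>0 < n\<close>.\<close>
      define n where "n = nat \<lfloor>t powr (1 / a)\<rfloor>"
      have fl: "real n \<le> t powr (1 / a)" "t powr (1 / a) < real (Suc n)"
      proof -
        have "real n = of_int \<lfloor>t powr (1 / a)\<rfloor>" unfolding n_def by (simp add: of_nat_nat)
        then show "real n \<le> t powr (1 / a)" "t powr (1 / a) < real (Suc n)" by linarith+
      qed
      have pow: "(t powr (1 / a)) powr a = t" using a0 t by (simp add: powr_powr)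
      have "u n \<le> (t powr (1 / a)) powr a" unfolding u_def using fl a0 by (intro powr_mono2) auto
      then have 1: "u n \<le> t" using pow by simp
      have "(t powr (1 / a)) powr a < u (Suc n)" unfolding u_def using fl a0 by (intro powr_less_mono2) auto
      then have 2: "t < u (Suc n)" using pow by simp
      have "real (Suc n0) powr a < real (Suc n) powr a" using 2 t by (simp add: u_def)
      then have "n0 < n" 
      proof (rule contrapos_pp)
        assume "\<not> n0 < n"
        then show "\<not> real (Suc n0) powr a < real (Suc n) powr a"
          using a0 by (simp add: not_less powr_mono2)
      qed
      then have "\<bar>Y t \<omega>\<bar> \<le> c' * sqrt (2 * ln t) + D" using osc[of n t] 1 2 by simp
      moreover have "D \<le> (c - c') * sqrt (2 * ln t)" using elim c' by (simp add: pos_divide_le_eq mult.commute)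
      ultimately show ?case by (simp add: algebra_simps)
    qed
  qed
qed

end

section \<open>The Volterra kernel\<close>

text \<open>The gauge integral is known. Nonnegativity upgrades it to a Lebesgue integral for the
  completed measure, and Borel measurability of the integrand brings it down to
  \<open>lborel\<close>.\<close>

lemma has_bochner_integral_powr_from_0:
  assumes "- 1 < (a::real)" "0 \<le> c"
  shows "has_bochner_integral lborel (\<lambda>x. indicator {0..c} x *\<^sub>R x powr a) (c powr (a + 1) / (a + 1))"
proof -
  have hi: "((\<lambda>x. x powr a) has_integral (c powr (a + 1) / (a + 1))) {0..c}"
    by (rule has_integral_powr_from_0[OF assms])
  then have ai: "(\<lambda>x. x powr a) absolutely_integrable_on {0..c}"
    by (intro nonnegative_absolutely_integrable_1) auto
  have m: "(\<lambda>x. indicator {0..c} x *\<^sub>R x powr a) \<in> borel_measurable lborel" by measurable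
  have "integrable lborel (\<lambda>x. indicator {0..c} x *\<^sub>R x powr a)"
    using ai integrable_completion[OF m] by (simp add: set_integrable_def)
  moreover have "(LINT x|lebesgue. indicator {0..c} x *\<^sub>R x powr a) = c powr (a + 1) / (a + 1)"
    using set_lebesgue_integral_eq_integral(2)[OF ai] hi
    by (simp add: set_lebesgue_integral_def integral_unique)
  ultimately show ?thesis
    using integral_completion[OF m] by (simp add: has_bochner_integral_iff)
qed

lemma has_bochner_integral_powr_shifted:
  assumes "- 1 < (a::real)" "m \<le> b"
  shows "has_bochner_integral lborel (\<lambda>u. indicator {m..b} u *\<^sub>R (u - m) powr a)
    ((b - m) powr (a + 1) / (a + 1))"
proof -
  have "has_bochner_integral lborel (\<lambda>x. indicator {0..b - m} (- m + 1 * x) *\<^sub>R (- m + 1 * x) powr a)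
      (((b - m) powr (a + 1) / (a + 1)) /\<^sub>R \<bar>1\<bar>)"
    using has_bochner_integral_powr_from_0[OF assms(1), of "b - m"] assms(2)
    by (intro lborel_has_bochner_integral_real_affine_iff[THEN iffD1]) auto
  moreover have "indicator {0..b - m} (- m + 1 * x) = (indicator {m..b} x :: real)" for x
    by (auto simp: indicator_def)
  ultimately show ?thesis by (simp add: algebra_simps)
qed

text \<open>The sum of the end point values covers both signs of \<beta>, that is, both directions
  of monotonicity.\<close>

lemma powr_le_add_powr:
  fixes s u b \<beta> :: real
  assumes "0 < s" "s \<le> u" "u \<le> b"
  shows "u powr \<beta> \<le> s powr \<beta> + b powr \<beta>"
proof (cases "0 \<le> \<beta>")
  case True
  then have "u powr \<beta> \<le> b powr \<beta>" using assms by (intro powr_mono2) auto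
  then show ?thesis by (simp add: add_increasing)
next
  case False
  then have "u powr \<beta> \<le> s powr \<beta>" using assms by (intro powr_mono2') auto
  then show ?thesis by (simp add: add_increasing2)
qed

text \<open>For \<open>s > 0\<close> the factor \<open>u powr \<beta>\<close> is bounded on the
  interval, so only the singularity of \<open>(u - s) powr \<gamma>\<close> at \<open>s\<close>
  remains, and \<gamma> > -1 makes it integrable.\<close>

lemma kernel_integrand_integrable:
  fixes s b \<beta> \<gamma> :: real
  assumes "- 1 < \<gamma>" "0 < s"
  shows "set_integrable lborel {s..b} (\<lambda>u. u powr \<beta> * (u - s) powr \<gamma>)"
proof (cases "s \<le> b")
  case True
  have "integrable lborel (\<lambda>u. (s powr \<beta> + b powr \<beta>) * (indicator {s..b} u *\<^sub>R (u - s) powr \<gamma>))"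
    using has_bochner_integral_powr_shifted[OF assms(1) True]
    by (intro integrable_mult_right) (auto simp: has_bochner_integral_iff)
  then show ?thesis unfolding set_integrable_def
  proof (rule Bochner_Integration.integrable_bound)
    show "AE u in lborel. norm (indicator {s..b} u *\<^sub>R (u powr \<beta> * (u - s) powr \<gamma>))
        \<le> norm ((s powr \<beta> + b powr \<beta>) * (indicator {s..b} u *\<^sub>R (u - s) powr \<gamma>))"
    proof (rule AE_I2)
      fix u
      show "norm (indicator {s..b} u *\<^sub>R (u powr \<beta> * (u - s) powr \<gamma>))
        \<le> norm ((s powr \<beta> + b powr \<beta>) * (indicator {s..b} u *\<^sub>R (u - s) powr \<gamma>))"
        using powr_le_add_powr[OF assms(2), of u b \<beta>]
        by (auto simp: indicator_def abs_mult intro!: mult_right_mono)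
    qed
  qed measurable
next
  case False
  then show ?thesis by (simp add: set_integrable_def)
qed

text \<open>Extension by zero makes the kernels of different times functions on one line, so that
  they can be subtracted and rescaled.\<close>

definition cut_kernel :: "real \<Rightarrow> real \<Rightarrow> real \<Rightarrow> real \<Rightarrow> real \<Rightarrow> real" where
  "cut_kernel \<alpha> \<beta> \<gamma> t s = indicator {0..t} s * volterra_kernel \<alpha> \<beta> \<gamma> t s"

text \<open>Substituting \<open>a * u\<close> in the inner integral produces
  \<open>a powr (\<beta> + \<gamma> + 1)\<close>, and the prefactor adds
  \<open>a powr \<alpha>\<close>. The exponent is H - 1/2; the missing 1/2 is the scaling of the
  Wiener process.\<close>

lemma cut_kernel_scaling:
  assumes "0 < a"
  shows "cut_kernel \<alpha> \<beta> \<gamma> (a * t) (a * s) = a powr (\<alpha> + \<beta> + \<gamma> + 1) * cut_kernel \<alpha> \<beta> \<gamma> t s"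
proof (cases "0 \<le> s \<and> s \<le> t")
  case True
  then have s: "0 \<le> s" "s \<le> t" by auto
  have "(LBINT u:{a * s..a * t}. u powr \<beta> * (u - a * s) powr \<gamma>)
      = \<bar>a\<bar> *\<^sub>R (\<integral>u. indicator {a * s..a * t} (0 + a * u) *\<^sub>R ((0 + a * u) powr \<beta> * (0 + a * u - a * s) powr \<gamma>) \<partial>lborel)"
    unfolding set_lebesgue_integral_def using assms by (intro lborel_integral_real_affine) auto
  also have "(\<integral>u. indicator {a * s..a * t} (0 + a * u) *\<^sub>R ((0 + a * u) powr \<beta> * (0 + a * u - a * s) powr \<gamma>) \<partial>lborel)
      = (\<integral>u. a powr (\<beta> + \<gamma>) * (indicator {s..t} u *\<^sub>R (u powr \<beta> * (u - s) powr \<gamma>)) \<partial>lborel)"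
  proof (rule Bochner_Integration.integral_cong[OF refl])
    fix u
    have ind: "indicator {a * s..a * t} (0 + a * u) = (indicator {s..t} u :: real)"
      using assms by (auto simp: indicator_def)
    show "indicator {a * s..a * t} (0 + a * u) *\<^sub>R ((0 + a * u) powr \<beta> * (0 + a * u - a * s) powr \<gamma>)
      = a powr (\<beta> + \<gamma>) * (indicator {s..t} u *\<^sub>R (u powr \<beta> * (u - s) powr \<gamma>))"
    proof (cases "u \<in> {s..t}")
      case True
      have "(0 + a * u - a * s) powr \<gamma> = a powr \<gamma> * (u - s) powr \<gamma>"
        using True assms by (simp add: right_diff_distrib[symmetric] powr_mult)
      moreover have "(0 + a * u) powr \<beta> = a powr \<beta> * u powr \<beta>"
        using True assms s by (simp add: powr_mult)
      ultimately show ?thesis unfolding ind by (simp add: powr_add)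
    next
      case False
      then show ?thesis unfolding ind by simp
    qed
  qed
  also have "\<dots> = a powr (\<beta> + \<gamma>) * (LBINT u:{s..t}. u powr \<beta> * (u - s) powr \<gamma>)"
    by (simp add: set_lebesgue_integral_def)
  finally have I: "(LBINT u:{a * s..a * t}. u powr \<beta> * (u - a * s) powr \<gamma>) =
      a * (a powr (\<beta> + \<gamma>) * (LBINT u:{s..t}. u powr \<beta> * (u - s) powr \<gamma>))"
    using assms by simp
  have "a powr (\<alpha> + \<beta> + \<gamma> + 1) = a powr \<alpha> * a powr (\<beta> + \<gamma>) * a"
    using assms by (simp add: powr_add)
  then show ?thesis
    using s assms unfolding cut_kernel_def volterra_kernel_def I by (simp add: powr_mult indicator_def)
next
  case False
  then have "s \<notin> {0..t}" "a * s \<notin> {0..a * t}" using assms by (auto simp: zero_le_mult_iff)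
  then show ?thesis by (simp add: cut_kernel_def)
qed

text \<open>For \<open>s \<le> 1\<close> the part of the inner integral over \<open>{s..1}\<close>
  cancels; for \<open>s > 1\<close> the kernel at time 1 vanishes. The lower limit
  \<open>max 1 s\<close> unites both cases. Time 1 as reference suffices by scaling.\<close>

lemma cut_kernel_difference:
  assumes \<gamma>: "- 1 < \<gamma>" and b: "1 \<le> b" "b \<le> exp 1" and s: "0 < s" "s \<le> b"
  shows "cut_kernel \<alpha> \<beta> \<gamma> b s - cut_kernel \<alpha> \<beta> \<gamma> 1 s =
    s powr \<alpha> * (LBINT u:{max 1 s<..b}. u powr \<beta> * (u - s) powr \<gamma>)"
proof (cases "s \<le> 1")
  case True
  let ?g = "\<lambda>u. u powr \<beta> * (u - s) powr \<gamma>"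
  have int: "set_integrable lborel {s..b} ?g" using \<gamma> s(1) by (rule kernel_integrand_integrable)
  have "(LBINT u:{s..1} \<union> {1<..b}. ?g u) = (LBINT u:{s..1}. ?g u) + (LBINT u:{1<..b}. ?g u)"
    using True b by (intro set_integral_Un set_integrable_subset[OF int]) auto
  moreover have "{s..1} \<union> {1<..b} = {s..b}" using True b by auto
  ultimately show ?thesis using True b s
    by (simp add: cut_kernel_def volterra_kernel_def algebra_simps max_def)
next
  case False
  have "(LBINT u:{s..b}. u powr \<beta> * (u - s) powr \<gamma>) = (LBINT u:{s<..b}. u powr \<beta> * (u - s) powr \<gamma>)"
    unfolding set_lebesgue_integral_def
    by (intro Bochner_Integration.integral_cong refl) (auto simp: indicator_def)
  then show ?thesis using False s by (simp add: cut_kernel_def volterra_kernel_def max_def)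
qed

text \<open>For \<gamma> < 0 the integrand is dominated by moving its singularity from
  \<open>s\<close> to the lower limit \<open>m = max 1 s\<close>, which gives the power \<gamma> + 1
  of the length. For \<gamma> \<ge> 0 it is bounded and the power is 1. Both read
  \<open>(u - m) powr (d - 1)\<close>. The factor \<open>s powr \<alpha>\<close> is kept for the
  later integration in \<open>s\<close>.\<close>

lemma cut_kernel_difference_le:
  assumes \<gamma>: "- 1 < \<gamma>" and b: "1 \<le> b" "b \<le> exp 1" and s: "0 < s" "s \<le> b"
  defines "d \<equiv> min 1 (\<gamma> + 1)"
  shows "\<bar>cut_kernel \<alpha> \<beta> \<gamma> b s - cut_kernel \<alpha> \<beta> \<gamma> 1 s\<bar> \<le>
    exp (\<bar>\<beta>\<bar> + \<bar>\<gamma>\<bar>) / d * (b - 1) powr d * s powr \<alpha>"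
proof -
  let ?g = "\<lambda>u. u powr \<beta> * (u - s) powr \<gamma>"
  define m where "m = max 1 s"
  have m: "1 \<le> m" "s \<le> m" "m \<le> b" using b s by (auto simp: m_def)
  have d: "0 < d" "- 1 < d - 1" using \<gamma> by (auto simp: d_def)
  let ?E = "exp (\<bar>\<beta>\<bar> + \<bar>\<gamma>\<bar>)"
  have dom: "integrable lborel (\<lambda>u. ?E * (indicator {m..b} u *\<^sub>R (u - m) powr (d - 1)))"
    "(\<integral>u. ?E * (indicator {m..b} u *\<^sub>R (u - m) powr (d - 1)) \<partial>lborel) = ?E * ((b - m) powr d / d)"
    using has_bochner_integral_powr_shifted[OF d(2) m(3)]
    by (auto simp: has_bochner_integral_iff simp del: real_scaleR_def mult_scaleR_right)
  have E: "x powr e \<le> exp \<bar>e\<bar>" if "1 \<le> x" "x \<le> exp 1" for x e :: real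
  proof -
    have "x powr e \<le> x powr \<bar>e\<bar>" using that by (intro powr_mono) auto
    also have "\<dots> \<le> exp 1 powr \<bar>e\<bar>" using that by (intro powr_mono2) auto
    finally show ?thesis by (simp add: exp_powr_real)
  qed
  \<comment> \<open>The point \<open>u = m\<close> has to be left out: there the right-hand side is
    0 because \<open>0 powr (d - 1) = 0\<close>, while the left-hand side is positive when
    \<open>s < 1\<close>. This is why the interval is half-open.\<close>
  have pw: "?g u \<le> ?E * (u - m) powr (d - 1)" if u: "m < u" "u \<le> b" for u
  proof -
    have 1: "u powr \<beta> \<le> exp \<bar>\<beta>\<bar>" using u m b by (intro E) auto
    have 2: "(u - s) powr \<gamma> \<le> exp \<bar>\<gamma>\<bar> * (u - m) powr (d - 1)"
    proof (cases "0 \<le> \<gamma>")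
      case True
      have "(u - s) powr \<gamma> \<le> exp 1 powr \<gamma>" using True u m b s by (intro powr_mono2) auto
      then show ?thesis using True u by (simp add: d_def exp_powr_real)
    next
      case False
      have "(u - s) powr \<gamma> \<le> (u - m) powr \<gamma>" using False u m by (intro powr_mono2') auto
      also have "\<dots> \<le> exp \<bar>\<gamma>\<bar> * (u - m) powr \<gamma>" by (simp add: mult_le_cancel_right1)
      finally show ?thesis using False by (simp add: d_def)
    qed
    have "?g u \<le> exp \<bar>\<beta>\<bar> * (exp \<bar>\<gamma>\<bar> * (u - m) powr (d - 1))"
      using 1 2 by (intro mult_mono) auto
    then show ?thesis by (simp add: exp_add mult.assoc)
  qed
  have "(LBINT u:{m<..b}. ?g u) \<le> (\<integral>u. ?E * (indicator {m..b} u *\<^sub>R (u - m) powr (d - 1)) \<partial>lborel)"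
    unfolding set_lebesgue_integral_def
  proof (rule integral_mono[OF _ dom(1)])
    have "set_integrable lborel {m<..b} ?g"
      by (rule set_integrable_subset[OF kernel_integrand_integrable[OF \<gamma> s(1), of b]]) (use m in auto)
    then show "integrable lborel (\<lambda>u. indicator {m<..b} u *\<^sub>R ?g u)" by (simp add: set_integrable_def)
    show "indicator {m<..b} u *\<^sub>R ?g u \<le> ?E * (indicator {m..b} u *\<^sub>R (u - m) powr (d - 1))" for u
      using pw[of u] by (auto simp: indicator_def)
  qed
  also have "\<dots> = ?E / d * (b - m) powr d" using dom(2) by simp
  also have "\<dots> \<le> ?E / d * (b - 1) powr d"
    using m d by (intro mult_left_mono powr_mono2) auto
  finally have le: "(LBINT u:{m<..b}. ?g u) \<le> ?E / d * (b - 1) powr d" .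
  have ge: "0 \<le> (LBINT u:{m<..b}. ?g u)"
    unfolding set_lebesgue_integral_def by (intro integral_nonneg_AE AE_I2) auto
  have "\<bar>cut_kernel \<alpha> \<beta> \<gamma> b s - cut_kernel \<alpha> \<beta> \<gamma> 1 s\<bar> = s powr \<alpha> * (LBINT u:{m<..b}. ?g u)"
    unfolding cut_kernel_difference[OF \<gamma> b s] m_def[symmetric] using ge by simp
  also have "\<dots> \<le> s powr \<alpha> * (?E / d * (b - 1) powr d)" using le by (intro mult_left_mono) auto
  finally show ?thesis by (simp add: mult.commute)
qed

text \<open>Squaring the pointwise bound leaves \<open>s powr (2 * \<alpha>)\<close>, integrable up
  to \<open>exp 1\<close> since \<alpha> > -1/2.\<close>

lemma nn_integral_cut_kernel_difference_le:
  assumes \<alpha>: "- 1 / 2 < \<alpha>" and \<gamma>: "- 1 < \<gamma>"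
  defines "d \<equiv> min 1 (\<gamma> + 1)"
  shows "\<exists>A\<ge>0. \<forall>b. 1 \<le> b \<longrightarrow> b \<le> exp 1 \<longrightarrow>
    (\<integral>\<^sup>+ s. ennreal ((cut_kernel \<alpha> \<beta> \<gamma> b s - cut_kernel \<alpha> \<beta> \<gamma> 1 s)\<^sup>2) \<partial>lborel) \<le>
      ennreal (A * (b - 1) powr (2 * d))"
proof -
  define E where "E = exp (\<bar>\<beta>\<bar> + \<bar>\<gamma>\<bar>) / d"
  define J where "J = exp 1 powr (2 * \<alpha> + 1) / (2 * \<alpha> + 1)"
  have J: "has_bochner_integral lborel (\<lambda>x. indicator {0..exp 1} x *\<^sub>R x powr (2 * \<alpha>)) J"
    unfolding J_def using \<alpha> by (intro has_bochner_integral_powr_from_0) auto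
  have J0: "0 \<le> J" using \<alpha> by (simp add: J_def)
  have "(\<integral>\<^sup>+ s. ennreal ((cut_kernel \<alpha> \<beta> \<gamma> b s - cut_kernel \<alpha> \<beta> \<gamma> 1 s)\<^sup>2) \<partial>lborel) \<le>
      ennreal (E\<^sup>2 * J * (b - 1) powr (2 * d))" if b: "1 \<le> b" "b \<le> exp 1" for b
  proof -
    have "(\<integral>\<^sup>+ s. ennreal ((cut_kernel \<alpha> \<beta> \<gamma> b s - cut_kernel \<alpha> \<beta> \<gamma> 1 s)\<^sup>2) \<partial>lborel) \<le>
        (\<integral>\<^sup>+ s. ennreal ((E\<^sup>2 * (b - 1) powr (2 * d)) * (indicator {0..exp 1} s *\<^sub>R s powr (2 * \<alpha>))) \<partial>lborel)"
    proof (rule nn_integral_mono_AE)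
      have "AE s in lborel. s \<noteq> (0::real)" by (rule AE_lborel_singleton)
      then show "AE s in lborel. ennreal ((cut_kernel \<alpha> \<beta> \<gamma> b s - cut_kernel \<alpha> \<beta> \<gamma> 1 s)\<^sup>2) \<le>
          ennreal ((E\<^sup>2 * (b - 1) powr (2 * d)) * (indicator {0..exp 1} s *\<^sub>R s powr (2 * \<alpha>)))"
      proof eventually_elim
        case (elim s)
        show ?case
        proof (cases "0 < s \<and> s \<le> b")
          case True
          then have le: "\<bar>cut_kernel \<alpha> \<beta> \<gamma> b s - cut_kernel \<alpha> \<beta> \<gamma> 1 s\<bar> \<le> E * (b - 1) powr d * s powr \<alpha>"
            using cut_kernel_difference_le[OF \<gamma> b, of s \<alpha> \<beta>] by (simp add: E_def d_def)
          have "(cut_kernel \<alpha> \<beta> \<gamma> b s - cut_kernel \<alpha> \<beta> \<gamma> 1 s)\<^sup>2 \<le> (E * (b - 1) powr d * s powr \<alpha>)\<^sup>2"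
            using power_mono[OF le abs_ge_zero, of 2] by simp
          also have "\<dots> = E\<^sup>2 * (b - 1) powr (2 * d) * s powr (2 * \<alpha>)"
          proof -
            have "(x powr e)\<^sup>2 = x powr (2 * e)" for x e :: real
              by (simp add: power2_eq_square powr_add[symmetric])
            then show ?thesis by (simp add: power_mult_distrib)
          qed
          finally show ?thesis using True b by (auto intro!: ennreal_leI)
        next
          case False
          then have "s \<notin> {0..b}" "s \<notin> {0..1}" using elim b by auto
          then show ?thesis by (simp add: cut_kernel_def)
        qed
      qed
    qed
    also have "\<dots> = ennreal ((E\<^sup>2 * (b - 1) powr (2 * d)) * J)"
      using J by (subst nn_integral_eq_integral)
        (auto simp: has_bochner_integral_iff simp del: real_scaleR_def mult_scaleR_right
          intro!: AE_I2 mult_nonneg_nonneg scaleR_nonneg_nonneg)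
    finally show ?thesis by (simp add: mult_ac)
  qed
  then show ?thesis using J0 by (intro exI[of _ "E\<^sup>2 * J"]) auto
qed

text \<open>The kernel of the Lamperti transform \<open>exp (- H u) X\<^bsub>exp u\<^esub>\<close>, where
  \<open>H = \<alpha> + \<beta> + \<gamma> + 3 / 2\<close> is the self-similarity index of \<open>X\<close>.\<close>

definition lamperti_kernel :: "real \<Rightarrow> real \<Rightarrow> real \<Rightarrow> real \<Rightarrow> real \<Rightarrow> real" where
  "lamperti_kernel \<alpha> \<beta> \<gamma> u s = exp (- (\<alpha> + \<beta> + \<gamma> + 3 / 2) * u) * cut_kernel \<alpha> \<beta> \<gamma> (exp u) s"

text \<open>The exponents add up to \<open>- H * (u + h) + (H - 1/2) * u = - u / 2 - H * h\<close>.
  The surviving factor \<open>exp (- u / 2)\<close> is the one that makes the dilation by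
  \<open>exp u\<close> preserve the norm of square integrable functions.\<close>

lemma lamperti_kernel_shift:
  "lamperti_kernel \<alpha> \<beta> \<gamma> (u + h) (exp u * r) = exp (- u / 2) * lamperti_kernel \<alpha> \<beta> \<gamma> h r"
proof -
  have "cut_kernel \<alpha> \<beta> \<gamma> (exp (u + h)) (exp u * r) = exp ((\<alpha> + \<beta> + \<gamma> + 1) * u) * cut_kernel \<alpha> \<beta> \<gamma> (exp h) r"
    using cut_kernel_scaling[of "exp u" \<alpha> \<beta> \<gamma> "exp h" r]
    by (simp add: exp_add exp_powr_real mult.commute)
  then have "lamperti_kernel \<alpha> \<beta> \<gamma> (u + h) (exp u * r) =
      exp (- (\<alpha> + \<beta> + \<gamma> + 3 / 2) * (u + h) + (\<alpha> + \<beta> + \<gamma> + 1) * u) * cut_kernel \<alpha> \<beta> \<gamma> (exp h) r"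
    by (simp add: lamperti_kernel_def exp_add)
  also have "- (\<alpha> + \<beta> + \<gamma> + 3 / 2) * (u + h) + (\<alpha> + \<beta> + \<gamma> + 1) * u = - u / 2 + - (\<alpha> + \<beta> + \<gamma> + 3 / 2) * h"
    by (simp add: algebra_simps)
  finally show ?thesis by (simp only: exp_add lamperti_kernel_def mult.assoc)
qed

text \<open>Stationarity of the Lamperti transform at the level of kernels: the Jacobian
  \<open>exp u\<close> cancels the squared factor \<open>exp (- u)\<close>. The free coefficients
  cover variances (0 and 1) as well as increments (1 and -1).\<close>

lemma nn_integral_lamperti_kernel_shift:
  assumes "\<And>t. 0 < t \<Longrightarrow> cut_kernel \<alpha> \<beta> \<gamma> t \<in> borel_measurable borel"
  shows "(\<integral>\<^sup>+ s. ennreal ((c * lamperti_kernel \<alpha> \<beta> \<gamma> (u + h) s + e * lamperti_kernel \<alpha> \<beta> \<gamma> u s)\<^sup>2) \<partial>lborel) =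
    (\<integral>\<^sup>+ s. ennreal ((c * lamperti_kernel \<alpha> \<beta> \<gamma> h s + e * cut_kernel \<alpha> \<beta> \<gamma> 1 s)\<^sup>2) \<partial>lborel)"
proof -
  have [measurable]: "lamperti_kernel \<alpha> \<beta> \<gamma> u \<in> borel_measurable borel" for u
    unfolding lamperti_kernel_def using assms by measurable
  have zero: "lamperti_kernel \<alpha> \<beta> \<gamma> 0 = cut_kernel \<alpha> \<beta> \<gamma> 1"
    by (simp add: lamperti_kernel_def fun_eq_iff)
  have [measurable]: "cut_kernel \<alpha> \<beta> \<gamma> 1 \<in> borel_measurable borel" using assms by simp
  have pt: "(c * lamperti_kernel \<alpha> \<beta> \<gamma> (u + h) (0 + exp u * s) + e * lamperti_kernel \<alpha> \<beta> \<gamma> u (0 + exp u * s))\<^sup>2 =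
      exp (- u) * (c * lamperti_kernel \<alpha> \<beta> \<gamma> h s + e * cut_kernel \<alpha> \<beta> \<gamma> 1 s)\<^sup>2" for s
  proof -
    have "c * lamperti_kernel \<alpha> \<beta> \<gamma> (u + h) (0 + exp u * s) + e * lamperti_kernel \<alpha> \<beta> \<gamma> u (0 + exp u * s)
        = exp (- u / 2) * (c * lamperti_kernel \<alpha> \<beta> \<gamma> h s + e * cut_kernel \<alpha> \<beta> \<gamma> 1 s)"
      using lamperti_kernel_shift[of \<alpha> \<beta> \<gamma> u h s] lamperti_kernel_shift[of \<alpha> \<beta> \<gamma> u 0 s]
      by (simp add: zero algebra_simps)
    moreover have "(exp (- u / 2))\<^sup>2 = exp (- u)"
      by (simp add: power2_eq_square exp_add[symmetric])
    ultimately show ?thesis by (simp add: power_mult_distrib)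
  qed
  have "(\<integral>\<^sup>+ s. ennreal ((c * lamperti_kernel \<alpha> \<beta> \<gamma> (u + h) s + e * lamperti_kernel \<alpha> \<beta> \<gamma> u s)\<^sup>2) \<partial>lborel) =
      ennreal \<bar>exp u\<bar> * (\<integral>\<^sup>+ s. ennreal ((c * lamperti_kernel \<alpha> \<beta> \<gamma> (u + h) (0 + exp u * s) +
        e * lamperti_kernel \<alpha> \<beta> \<gamma> u (0 + exp u * s))\<^sup>2) \<partial>lborel)"
    by (rule nn_integral_real_affine) auto
  also have "\<dots> = ennreal (exp u) * (\<integral>\<^sup>+ s. ennreal (exp (- u)) *
      ennreal ((c * lamperti_kernel \<alpha> \<beta> \<gamma> h s + e * cut_kernel \<alpha> \<beta> \<gamma> 1 s)\<^sup>2) \<partial>lborel)"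
    unfolding pt by (simp add: ennreal_mult)
  also have "\<dots> = ennreal (exp u) * ennreal (exp (- u)) *
      (\<integral>\<^sup>+ s. ennreal ((c * lamperti_kernel \<alpha> \<beta> \<gamma> h s + e * cut_kernel \<alpha> \<beta> \<gamma> 1 s)\<^sup>2) \<partial>lborel)"
    by (subst nn_integral_cmult) (auto simp: mult.assoc)
  also have "ennreal (exp u) * ennreal (exp (- u)) = 1"
    by (simp add: ennreal_mult[symmetric] exp_minus_inverse)
  finally show ?thesis by simp
qed

section \<open>The law of the iterated logarithm\<close>

text \<open>Stationarity moves the increment to \<open>u = 0\<close>. There it splits into a kernel
  increment from time 1 to \<open>exp h\<close>, of order \<open>h powr d\<close>, and a multiple of
  the kernel at time 1 caused by the change of the normalising factor, of order \<open>h\<close>,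
  which is no larger because \<open>h \<le> 1\<close> and \<open>d \<le> 1\<close>.\<close>

lemma nn_integral_lamperti_kernel_increment_le:
  fixes \<alpha> \<beta> \<gamma> :: real
  assumes \<alpha>: "- 1 / 2 < \<alpha>" and \<gamma>: "- 1 < \<gamma>" and H: "0 < \<alpha> + \<beta> + \<gamma> + 3 / 2"
    and meas: "\<And>t. 0 < t \<Longrightarrow> cut_kernel \<alpha> \<beta> \<gamma> t \<in> borel_measurable borel"
    and fin: "(\<integral>\<^sup>+ s. ennreal ((cut_kernel \<alpha> \<beta> \<gamma> 1 s)\<^sup>2) \<partial>lborel) < \<infinity>"
  defines "d \<equiv> min 1 (\<gamma> + 1)"
  shows "\<exists>C\<ge>0. \<forall>u h. 0 < h \<longrightarrow> h \<le> 1 \<longrightarrow>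
    (\<integral>\<^sup>+ s. ennreal ((lamperti_kernel \<alpha> \<beta> \<gamma> (u + h) s - lamperti_kernel \<alpha> \<beta> \<gamma> u s)\<^sup>2) \<partial>lborel) \<le>
      ennreal (C * h powr (2 * d))"
proof -
  let ?H = "\<alpha> + \<beta> + \<gamma> + 3 / 2"
  have d: "0 < d" "d \<le> 1" using \<gamma> by (auto simp: d_def)
  have [measurable]: "cut_kernel \<alpha> \<beta> \<gamma> 1 \<in> borel_measurable borel" using meas by simp
  obtain A where A: "0 \<le> A" "\<And>b. 1 \<le> b \<Longrightarrow> b \<le> exp 1 \<Longrightarrow>
    (\<integral>\<^sup>+ s. ennreal ((cut_kernel \<alpha> \<beta> \<gamma> b s - cut_kernel \<alpha> \<beta> \<gamma> 1 s)\<^sup>2) \<partial>lborel) \<le>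
      ennreal (A * (b - 1) powr (2 * d))"
    using nn_integral_cut_kernel_difference_le[OF \<alpha> \<gamma>] unfolding d_def by metis
  obtain V where V: "0 \<le> V" "(\<integral>\<^sup>+ s. ennreal ((cut_kernel \<alpha> \<beta> \<gamma> 1 s)\<^sup>2) \<partial>lborel) = ennreal V"
    using fin by (auto simp: less_top_ennreal)
  have "(\<integral>\<^sup>+ s. ennreal ((lamperti_kernel \<alpha> \<beta> \<gamma> (u + h) s - lamperti_kernel \<alpha> \<beta> \<gamma> u s)\<^sup>2) \<partial>lborel) \<le>
      ennreal ((8 * A + 2 * ?H\<^sup>2 * V) * h powr (2 * d))" if h: "0 < h" "h \<le> 1" for u h
  proof -
    have [measurable]: "cut_kernel \<alpha> \<beta> \<gamma> (exp h) \<in> borel_measurable borel" using meas by simp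
    define a where "a = exp (- ?H * h)"
    have a: "0 \<le> a" "a \<le> 1" "1 - a \<le> ?H * h"
    proof -
      have "0 \<le> ?H * h" using H h by (intro mult_nonneg_nonneg) auto
      then show "0 \<le> a" "a \<le> 1" unfolding a_def mult_minus_left by auto
      have "1 + - ?H * h \<le> a" unfolding a_def by (rule exp_ge_add_one_self)
      then show "1 - a \<le> ?H * h" unfolding mult_minus_left by linarith
    qed
    have h2: "h\<^sup>2 \<le> h powr (2 * d)"
    proof -
      have "h powr 2 \<le> h powr (2 * d)" using h d by (intro powr_mono') auto
      then show ?thesis using h by simp
    qed
    have e: "1 \<le> exp h" "exp h \<le> exp 1" "exp h - 1 \<le> 2 * h"
    proof -
      show "1 \<le> exp h" "exp h \<le> exp 1" using h by auto
      have "exp h \<le> 1 + h + h\<^sup>2" using h by (intro exp_bound) auto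
      moreover have "h\<^sup>2 \<le> h" using h by (simp add: power2_eq_square mult_left_le)
      ultimately show "exp h - 1 \<le> 2 * h" by linarith
    qed
    have "(exp h - 1) powr (2 * d) \<le> (2 * h) powr (2 * d)" using e d by (intro powr_mono2) auto
    also have "\<dots> = 2 powr (2 * d) * h powr (2 * d)" using h by (simp add: powr_mult)
    also have "\<dots> \<le> 2 powr 2 * h powr (2 * d)" using d by (intro mult_right_mono powr_mono) auto
    finally have eh: "(exp h - 1) powr (2 * d) \<le> 4 * h powr (2 * d)" by simp
    have "(\<integral>\<^sup>+ s. ennreal ((lamperti_kernel \<alpha> \<beta> \<gamma> (u + h) s - lamperti_kernel \<alpha> \<beta> \<gamma> u s)\<^sup>2) \<partial>lborel)
        = (\<integral>\<^sup>+ s. ennreal ((1 * lamperti_kernel \<alpha> \<beta> \<gamma> h s + (-1) * cut_kernel \<alpha> \<beta> \<gamma> 1 s)\<^sup>2) \<partial>lborel)"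
      using nn_integral_lamperti_kernel_shift[OF meas, where c=1 and e="-1" and u=u and h=h] by simp
    \<comment> \<open>The identity \<open>a * x - y = a * (x - y) + (a - 1) * y\<close> separates
      the kernel increment from the change of normalisation.\<close>
    also have "\<dots> = (\<integral>\<^sup>+ s. ennreal ((a * (cut_kernel \<alpha> \<beta> \<gamma> (exp h) s - cut_kernel \<alpha> \<beta> \<gamma> 1 s) +
        (a - 1) * cut_kernel \<alpha> \<beta> \<gamma> 1 s)\<^sup>2) \<partial>lborel)"
      by (simp add: lamperti_kernel_def a_def algebra_simps)
    also have "\<dots> \<le> ennreal (2 * a\<^sup>2) * (\<integral>\<^sup>+ s. ennreal ((cut_kernel \<alpha> \<beta> \<gamma> (exp h) s - cut_kernel \<alpha> \<beta> \<gamma> 1 s)\<^sup>2) \<partial>lborel)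
        + ennreal (2 * (a - 1)\<^sup>2) * (\<integral>\<^sup>+ s. ennreal ((cut_kernel \<alpha> \<beta> \<gamma> 1 s)\<^sup>2) \<partial>lborel)"
      by (rule nn_integral_square_combination_le) measurable
    also have "\<dots> \<le> ennreal 2 * ennreal (A * (4 * h powr (2 * d))) + ennreal (2 * (?H\<^sup>2 * h powr (2 * d))) * ennreal V"
    proof (intro add_mono mult_mono)
      show "ennreal (2 * a\<^sup>2) \<le> ennreal 2" using a by (intro ennreal_leI) (simp add: power_le_one)
      have "A * (exp h - 1) powr (2 * d) \<le> A * (4 * h powr (2 * d))" using A(1) eh by (rule mult_left_mono[rotated])
      with A(2)[OF e(1,2)]
      show "(\<integral>\<^sup>+ s. ennreal ((cut_kernel \<alpha> \<beta> \<gamma> (exp h) s - cut_kernel \<alpha> \<beta> \<gamma> 1 s)\<^sup>2) \<partial>lborel)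
          \<le> ennreal (A * (4 * h powr (2 * d)))"
        by (meson ennreal_leI order_trans)
      have "(a - 1)\<^sup>2 = (1 - a)\<^sup>2" by (rule power2_commute)
      also have "\<dots> \<le> (?H * h)\<^sup>2" using a by (intro power_mono) auto
      also have "\<dots> = ?H\<^sup>2 * h\<^sup>2" by (rule power_mult_distrib)
      also have "\<dots> \<le> ?H\<^sup>2 * h powr (2 * d)" using h2 by (intro mult_left_mono) auto
      finally show "ennreal (2 * (a - 1)\<^sup>2) \<le> ennreal (2 * (?H\<^sup>2 * h powr (2 * d)))"
        by (intro ennreal_leI) simp
    qed (use V in auto)
    also have "\<dots> = ennreal (2 * (A * (4 * h powr (2 * d))) + 2 * (?H\<^sup>2 * h powr (2 * d)) * V)"
    proof -
      have "ennreal 2 * ennreal x + ennreal y * ennreal V = ennreal (2 * x + y * V)"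
        if "0 \<le> x" "0 \<le> y" for x y
        using that V(1) by (simp only: ennreal_mult[symmetric] ennreal_plus[symmetric]
            mult_nonneg_nonneg zero_le_numeral)
      then show ?thesis using A(1) by simp
    qed
    finally show ?thesis by (simp add: algebra_simps)
  qed
  then show ?thesis using A(1) V(1) by (intro exI[of _ "8 * A + 2 * ?H\<^sup>2 * V"]) auto
qed

lemma SUP_less_infinity_of_eventually_le:
  fixes f :: "real \<Rightarrow> real"
  assumes cont: "continuous_on {a..} f" and ev: "eventually (\<lambda>t. f t \<le> c) at_top"
  shows "(SUP t\<in>{a..}. ereal (f t)) < \<infinity>"
proof -
  obtain T where T: "\<And>t. T \<le> t \<Longrightarrow> f t \<le> c" using ev by (auto simp: eventually_at_top_linorder)
  have "compact (f ` {a..T})"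
    by (intro compact_continuous_image continuous_on_subset[OF cont]) auto
  then have "bdd_above (f ` {a..T})" by (intro bounded_imp_bdd_above compact_imp_bounded)
  then obtain B where B: "\<And>t. t \<in> {a..T} \<Longrightarrow> f t \<le> B"
    unfolding bdd_above_def by blast
  have "(SUP t\<in>{a..}. ereal (f t)) \<le> ereal (max B c)"
  proof (rule SUP_least)
    fix t assume "t \<in> {a..}"
    then show "ereal (f t) \<le> ereal (max B c)"
      using T[of t] B[of t] by (cases "T \<le> t") (auto simp: le_max_iff_disj)
  qed
  also have "\<dots> < \<infinity>" by (simp add: max_def)
  finally show ?thesis .
qed

theorem theorem2p3:
  fixes M :: "'a measure" and W X :: "real \<Rightarrow> 'a \<Rightarrow> real" and \<alpha> \<beta> \<gamma> :: real
  assumes "\<alpha> > - 1 / 2" and "\<gamma> > - 1" and "\<alpha> + \<beta> + \<gamma> > - 3 / 2"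
    and "wiener_process M W"
    and "continuous_volterra_process M W \<alpha> \<beta> \<gamma> X"
  shows "integrable M (\<lambda>\<omega>. (X 1 \<omega>)\<^sup>2) \<and>
    (AE \<omega> in M.
      Limsup at_top (\<lambda>t. ereal (\<bar>X t \<omega>\<bar> / (t powr (\<alpha> + \<beta> + \<gamma> + 3 / 2) * sqrt (2 * ln (ln t)))))
        \<le> ereal (sqrt (\<integral>\<omega>'. (X 1 \<omega>')\<^sup>2 \<partial>M)) \<and>
      (SUP t\<in>{3..}. ereal (\<bar>X t \<omega>\<bar> / (t powr (\<alpha> + \<beta> + \<gamma> + 3 / 2) * sqrt (ln (ln t)))))
        < \<infinity>)"
proof -
  interpret wiener_process M W by fact
  define H where "H = \<alpha> + \<beta> + \<gamma> + 3 / 2"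
  have H: "0 < H" using assms(3) by (simp add: H_def)
  have lim: "wiener_limit M W (cut_kernel \<alpha> \<beta> \<gamma> t) (X t)" if "0 < t" for t
    unfolding cut_kernel_def[abs_def]
    by (rule has_wiener_integral_imp_wiener_limit)
      (use assms(5) that in \<open>simp add: continuous_volterra_process_def\<close>)
  have cont: "AE \<omega> in M. continuous_on {0..} (\<lambda>t. X t \<omega>)"
    using assms(5) by (simp add: continuous_volterra_process_def)
  have meas: "cut_kernel \<alpha> \<beta> \<gamma> t \<in> borel_measurable borel" if "0 < t" for t
    using lim[OF that] by (simp add: wiener_limit_def)
  have [measurable]: "X t \<in> borel_measurable M" if "0 < t" for t
    using lim[OF that] by (simp add: wiener_limit_def)
  have [measurable]: "X 1 \<in> borel_measurable M" by simp
  have fin: "(\<integral>\<^sup>+ s. ennreal ((cut_kernel \<alpha> \<beta> \<gamma> 1 s)\<^sup>2) \<partial>lborel) < \<infinity>"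
    using wiener_limit_square_integrable[OF lim] by simp
  have iso: "(\<integral>\<^sup>+ \<omega>. ennreal ((X 1 \<omega>)\<^sup>2) \<partial>M) = (\<integral>\<^sup>+ s. ennreal ((cut_kernel \<alpha> \<beta> \<gamma> 1 s)\<^sup>2) \<partial>lborel)"
    using wiener_limit_isometry[OF lim] by simp
  \<comment> \<open>Finiteness of the second moment is inherited from the kernel, whose square
    integrability follows from the existence of the Wiener integral.\<close>
  have int: "integrable M (\<lambda>\<omega>. (X 1 \<omega>)\<^sup>2)"
    using fin iso by (intro integrableI_nonneg) auto
  define v where "v = (\<integral>\<omega>. (X 1 \<omega>)\<^sup>2 \<partial>M)"
  have v0: "0 \<le> v" by (simp add: v_def)
  have v: "(\<integral>\<^sup>+ s. ennreal ((cut_kernel \<alpha> \<beta> \<gamma> 1 s)\<^sup>2) \<partial>lborel) = ennreal v"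
    unfolding iso[symmetric] v_def using int by (intro nn_integral_eq_integral) auto

  define Y where "Y u \<omega> = exp (- H * u) * X (exp u) \<omega>" for u \<omega>
  have Y_lim: "wiener_limit M W (lamperti_kernel \<alpha> \<beta> \<gamma> u) (Y u)" for u
    using wiener_limit_combination[OF lim[of "exp u"] lim[of 1], where a="exp (- H * u)" and b=0]
    by (simp add: lamperti_kernel_def[abs_def] Y_def[abs_def] H_def)
  have Y_var: "(\<integral>\<^sup>+ s. ennreal ((lamperti_kernel \<alpha> \<beta> \<gamma> u s)\<^sup>2) \<partial>lborel) = ennreal v" for u
    using nn_integral_lamperti_kernel_shift[OF meas, where c=0 and e=1 and u=u] by (simp add: v)
  define d where "d = min 1 (\<gamma> + 1)"
  have d: "0 < d" using assms(2) by (simp add: d_def)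
  obtain C where C: "0 \<le> C" "\<And>u h. 0 < h \<Longrightarrow> h \<le> 1 \<Longrightarrow>
    (\<integral>\<^sup>+ s. ennreal ((lamperti_kernel \<alpha> \<beta> \<gamma> (u + h) s - lamperti_kernel \<alpha> \<beta> \<gamma> u s)\<^sup>2) \<partial>lborel) \<le>
      ennreal (C * h powr (2 * d))"
    using nn_integral_lamperti_kernel_increment_le[of \<alpha> \<gamma> \<beta>, OF _ assms(2) _ meas fin] assms(1) H
    unfolding d_def H_def by auto
  have growth: "AE \<omega> in M. eventually (\<lambda>u. \<bar>Y u \<omega>\<bar> \<le> c * sqrt (2 * ln u)) at_top" if "sqrt v < c" for c
  proof (rule AE_eventually_le_sqrt_ln[where v=v and C="C + 1" and d=d])
    show "Y u \<in> borel_measurable M" for u using Y_lim by (simp add: wiener_limit_def)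
    show "prob {\<omega> \<in> space M. y \<le> \<bar>Y u \<omega>\<bar>} \<le> 2 * exp (- y\<^sup>2 / (2 * w))" if "v < w" "0 \<le> y" for w u y
      using that v0 by (intro wiener_limit_tail[OF Y_lim]) (auto simp: Y_var ennreal_less_iff)
    show "prob {\<omega> \<in> space M. y \<le> \<bar>Y (u + h) \<omega> - Y u \<omega>\<bar>} \<le> 2 * exp (- y\<^sup>2 / (2 * ((C + 1) * h powr (2 * d))))"
      if h: "0 < h" "h \<le> 1" and y: "0 \<le> y" for u h y
    proof (rule wiener_limit_tail[OF _ _ y])
      show "wiener_limit M W (\<lambda>s. lamperti_kernel \<alpha> \<beta> \<gamma> (u + h) s - lamperti_kernel \<alpha> \<beta> \<gamma> u s)
          (\<lambda>\<omega>. Y (u + h) \<omega> - Y u \<omega>)"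
        using wiener_limit_combination[OF Y_lim[of "u + h"] Y_lim[of u], where a=1 and b="-1"] by simp
      \<comment> \<open>The tail bound requires strict inequality and a positive constant, hence
        \<open>C + 1\<close>, as \<open>C\<close> may be 0.\<close>
      have "ennreal (C * h powr (2 * d)) < ennreal ((C + 1) * h powr (2 * d))"
        using C(1) h by (intro ennreal_lessI) (auto simp: distrib_right intro!: add_nonneg_pos)
      then show "(\<integral>\<^sup>+ s. ennreal ((lamperti_kernel \<alpha> \<beta> \<gamma> (u + h) s - lamperti_kernel \<alpha> \<beta> \<gamma> u s)\<^sup>2) \<partial>lborel)
          < ennreal ((C + 1) * h powr (2 * d))"
        using C(2)[OF h] by (rule le_less_trans[rotated])
    qed
    show "AE \<omega> in M. continuous_on {0..} (\<lambda>u. Y u \<omega>)"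
      using cont
    proof eventually_elim
      case (elim \<omega>)
      have "continuous_on {0..} (\<lambda>u. X (exp u) \<omega>)"
        by (rule continuous_on_compose2[OF elim]) (auto intro: continuous_intros)
      then show ?case unfolding Y_def by (intro continuous_intros)
    qed
  qed (use C d v0 that in auto)

  define Q where "Q t \<omega> = \<bar>X t \<omega>\<bar> / (t powr H * sqrt (2 * ln (ln t)))" for t \<omega>
  have Q_le: "AE \<omega> in M. eventually (\<lambda>t. Q t \<omega> \<le> c) at_top" if "sqrt v < c" for c
    using growth[OF that]
  proof eventually_elim
    case (elim \<omega>)
    \<comment> \<open>The Lamperti transform is undone by \<open>u = ln t\<close>, which turns
      \<open>ln u\<close> into the iterated logarithm.\<close>
    have "eventually (\<lambda>t. \<bar>Y (ln t) \<omega>\<bar> \<le> c * sqrt (2 * ln (ln t))) at_top"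
      by (rule eventually_compose_filterlim[OF elim ln_at_top])
    then show ?case using eventually_gt_at_top[of "exp 1"]
    proof eventually_elim
      case (elim t)
      have t: "0 < t" using elim(2) by (rule less_trans[OF exp_gt_zero])
      have "ln (exp 1) < ln t" using elim(2) t by (subst ln_less_cancel_iff) auto
      then have "1 < ln t" by simp
      then have pos: "0 < sqrt (2 * ln (ln t))" by simp
      have "Y (ln t) \<omega> = X t \<omega> / t powr H"
        using t by (simp add: Y_def powr_def exp_minus divide_inverse mult.commute)
      then have "\<bar>X t \<omega>\<bar> / t powr H \<le> c * sqrt (2 * ln (ln t))" using elim(1) by simp
      then have "\<bar>X t \<omega>\<bar> / t powr H / sqrt (2 * ln (ln t)) \<le> c"
        using pos by (simp only: pos_divide_le_eq)
      then show ?case by (simp add: Q_def)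
    qed
  qed

  \<comment> \<open>Countably many constants decreasing to \<open>sqrt v\<close> keep the
    exceptional sets within one null set.\<close>
  have "AE \<omega> in M. \<forall>n::nat. eventually (\<lambda>t. Q t \<omega> \<le> sqrt v + 1 / Suc n) at_top"
    unfolding AE_all_countable by (intro allI Q_le) simp
  then have "AE \<omega> in M. Limsup at_top (\<lambda>t. ereal (Q t \<omega>)) \<le> ereal (sqrt v) \<and>
      (SUP t\<in>{3..}. ereal (\<bar>X t \<omega>\<bar> / (t powr H * sqrt (ln (ln t))))) < \<infinity>"
    using cont
  proof eventually_elim
    case (elim \<omega>)
    have "Limsup at_top (\<lambda>t. ereal (Q t \<omega>)) \<le> ereal (sqrt v)"
    proof (rule LIMSEQ_le_const)
      have "(\<lambda>n. sqrt v + 1 / real (Suc n)) \<longlonglongrightarrow> sqrt v + 0"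
        by (intro tendsto_add tendsto_const lim_1_over_n[THEN LIMSEQ_Suc])
      then show "(\<lambda>n. ereal (sqrt v + 1 / real (Suc n))) \<longlonglongrightarrow> ereal (sqrt v)" by simp
      have "Limsup at_top (\<lambda>t. ereal (Q t \<omega>)) \<le> ereal (sqrt v + 1 / real (Suc n))" for n
        using elim(1)[rule_format, of n] by (intro Limsup_bounded) simp
      then show "\<exists>N. \<forall>n\<ge>N. Limsup at_top (\<lambda>t. ereal (Q t \<omega>)) \<le> ereal (sqrt v + 1 / real (Suc n))"
        by blast
    qed
    moreover have "(SUP t\<in>{3..}. ereal (\<bar>X t \<omega>\<bar> / (t powr H * sqrt (ln (ln t))))) < \<infinity>"
    proof (rule SUP_less_infinity_of_eventually_le)
      \<comment> \<open>Since \<open>3 > e\<close>, the denominator has no zero on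
        \<open>{3..}\<close> and the quotient is continuous there.\<close>
      have lnln: "0 < ln (ln t)" if "3 \<le> t" for t :: real
      proof -
        have "ln 3 \<le> ln t" using that by simp
        then have "1 < ln t" using ln3_gt_1 by linarith
        then show ?thesis by simp
      qed
      show "continuous_on {3..} (\<lambda>t. \<bar>X t \<omega>\<bar> / (t powr H * sqrt (ln (ln t))))"
      proof (intro continuous_intros continuous_on_subset[OF elim(2)] ballI)
        fix t :: real assume t: "t \<in> {3..}"
        then have "0 < ln (ln t)" "0 < t" using lnln by auto
        then show "ln t \<noteq> 0" "t powr H * sqrt (ln (ln t)) \<noteq> 0" by auto
      qed auto
      \<comment> \<open>The instance \<open>n = 0\<close> of the eventual bound, with
        \<open>sqrt 2\<close> compensating for the normalisation without the factor 2.\<close>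
      show "eventually (\<lambda>t. \<bar>X t \<omega>\<bar> / (t powr H * sqrt (ln (ln t))) \<le> sqrt 2 * (sqrt v + 1)) at_top"
        using elim(1)[rule_format, of 0]
      proof eventually_elim
        case (elim t)
        have "\<bar>X t \<omega>\<bar> / (t powr H * sqrt (ln (ln t))) = sqrt 2 * Q t \<omega>"
          by (simp add: Q_def real_sqrt_mult)
        also have "\<dots> \<le> sqrt 2 * (sqrt v + 1)" using elim by (intro mult_left_mono) auto
        finally show ?case .
      qed
    qed
    ultimately show ?case by blast
  qed
  then show ?thesis unfolding Q_def H_def v_def using int by (intro conjI)
qed

end
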